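(* Let $\mathcal{H}$ be a separable infinite-dimensional Hilbert space and let $\mathcal{Y}\subset\mathcal{H}$ be the range of a compact operator of infinite rank from a separable infinite-dimensional Hilbert space into $\mathcal{H}$. Then: (i) If the closure $\overline{\mathcal{Y}}$ has finite codimension in $\mathcal{H}$, then the algebra $\mathcal{A}(\mathcal{Y})$ is weakly full. (ii) If $\mathcal{Y}$ is not lacunary and $\mathrm{codim}(\overline{\mathcal{Y}})=\infty$, then $\mathcal{A}(\mathcal{Y})$ is not weakly full. (iii) If $\mathcal{Y}$ is lacunary, then $\mathcal{A}(\mathcal{Y})$ is weakly full.
   Context: $\mathcal{A}(\mathcal{Y})=\{T\in\mathcal{L}(\mathcal{H}): T\mathcal{Y}\subset\mathcal{Y}\}$ is the algebra of all bounded operators on $\mathcal{H}$ leaving $\mathcal{Y}$ invariant. An algebra $\mathcal{A}\subset\mathcal{L}(\mathcal{H})$ is called weakly full if for each operator $T\in\mathcal{A}$ that is invertible in $\mathcal{L}(\mathcal{H})$, the operator $T^{-1}$ belongs to the closure of $\mathcal{A}$ in the weak operator topology. If $\mathcal{Y}=A\mathcal{H}'$ with $A$ compact of infinite rank, then $K=A(B_{\mathcal{H}'})$ ($B_{\mathcal{H}'}$ the closed unit ball) is called a generating ellipsoid of $\mathcal{Y}$. The Kolmogorov $n$-width of $K$ is $d_n(K)=\inf_{\mathcal{X}_n}\sup_{x\in K}\inf_{z\in \mathcal{X}_n}\|x-z\|$, the outer infimum being over all $n$-dimensional linear subspaces of $\mathcal{H}$. A non-increasing sequence of positive numbers $a_n\to0$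 is lacunary if $\liminf_{n\to\infty}a_{n+1}/a_n=0$. The operator range $\mathcal{Y}$ is called lacunary if $\{d_n(K)\}_{n=0}^\infty$ is lacunary for a generating ellipsoid $K$ of $\mathcal{Y}$ (this does not depend on the choice of $K$). *)

theory Defs
  imports "HOL-Analysis.Analysis"
begin

section \<open>Hilbert spaces over the real or the complex numbers\<close>

text \<open>
  The distribution only has real inner product spaces as type classes. To treat real and complex
  Hilbert spaces at once, the scalars are abstracted: by the Gelfand-Mazur theorem the only
  models of the following class are the real numbers (with trivial conjugation) and the complex
  numbers (with the usual conjugation).
\<close>

class hilbert_scalar = real_normed_field + heine_borel +
  fixes sconj :: "'a \<Rightarrow> 'a"
  assumes sconj_add: "sconj (x + y) = sconj x + sconj y"
    and sconj_mult: "sconj (x * y) = sconj x * sconj y"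
    and mult_sconj: "x * sconj x = (norm x)\<^sup>2 *\<^sub>R 1"

instantiation real :: hilbert_scalar
begin
definition sconj_real :: "real \<Rightarrow> real" where "sconj_real x = x"
instance by standard (simp_all add: sconj_real_def power2_eq_square)
end

instantiation complex :: hilbert_scalar
begin
definition sconj_complex :: "complex \<Rightarrow> complex" where "sconj_complex = cnj"
instance
  by standard (simp_all add: sconj_complex_def scaleR_conv_of_real complex_norm_square[symmetric] del: of_real_power)
end

text \<open>
  Completeness is in the sort \<open>banach\<close>; the last axiom says that the norm of the type is the one
  given by the inner product \<open>ip\<close>, which is linear in its first argument.
\<close>

locale hilbert_space = vector_space smul
  for smul :: "'k::hilbert_scalar \<Rightarrow> 'h::banach \<Rightarrow> 'h" +
  fixes ip :: "'h \<Rightarrow> 'h \<Rightarrow> 'k"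
  assumes smul_of_real: "smul (of_real r) x = r *\<^sub>R x"
    and ip_add_left: "ip (x + y) z = ip x z + ip y z"
    and ip_smul_left: "ip (smul c x) y = c * ip x y"
    and ip_sconj: "ip y x = sconj (ip x y)"
    and ip_norm: "ip x x = of_real ((norm x)\<^sup>2)"

lemma hilbert_space_real:
  "hilbert_space ((*\<^sub>R) :: real \<Rightarrow> 'a \<Rightarrow> 'a::{real_inner, banach}) inner"
  by unfold_locales
    (simp_all add: algebra_simps inner_commute sconj_real_def power2_norm_eq_inner)

lemma hilbert_space_complex:
  "hilbert_space ((*) :: complex \<Rightarrow> complex \<Rightarrow> complex) (\<lambda>x y. x * cnj y)"
  by unfold_locales
    (simp_all add: algebra_simps sconj_complex_def complex_norm_square[symmetric] scaleR_conv_of_real)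

definition finite_dim :: "('k::field \<Rightarrow> 'h::ab_group_add \<Rightarrow> 'h) \<Rightarrow> 'h set \<Rightarrow> bool" where
  "finite_dim smul X \<longleftrightarrow> (\<exists>B. finite B \<and> module.span smul B = X)"

text \<open>
  The function \<open>vector_space.dim\<close> is \<open>0\<close> on infinite-dimensional spaces, hence the explicit basis.
\<close>

definition subspace_of_dim ::
  "('k::field \<Rightarrow> 'h::ab_group_add \<Rightarrow> 'h) \<Rightarrow> nat \<Rightarrow> 'h set \<Rightarrow> bool" where
  "subspace_of_dim smul n X \<longleftrightarrow>
    (\<exists>B. finite B \<and> card B = n \<and> \<not> module.dependent smul B \<and> module.span smul B = X)"

text \<open>
  Finite codimension of a linear subspace \<open>M\<close>: it has a finite-dimensional algebraic complement
  (which is then isomorphic to the quotient by \<open>M\<close>).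
\<close>

definition finite_codim :: "('k::field \<Rightarrow> 'h::ab_group_add \<Rightarrow> 'h) \<Rightarrow> 'h set \<Rightarrow> bool" where
  "finite_codim smul M \<longleftrightarrow>
    (\<exists>F. finite_dim smul F \<and> M \<inter> F = {0} \<and> (\<forall>x. \<exists>m\<in>M. \<exists>f\<in>F. x = m + f))"

section \<open>Operators and the weak operator topology\<close>

definition bounded_ops ::
  "('k \<Rightarrow> 'g::real_normed_vector \<Rightarrow> 'g) \<Rightarrow> ('k \<Rightarrow> 'h::real_normed_vector \<Rightarrow> 'h) \<Rightarrow> ('g \<Rightarrow> 'h) set"
where
  "bounded_ops smulG smulH =
    {T. bounded_linear T \<and> (\<forall>c x. T (smulG c x) = smulH c (T x))}"

definition compact_operator ::
  "('k \<Rightarrow> 'g::real_normed_vector \<Rightarrow> 'g) \<Rightarrow> ('k \<Rightarrow> 'h::real_normed_vector \<Rightarrow> 'h) \<Rightarrow> ('g \<Rightarrow> 'h) \<Rightarrow> bool"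
where
  "compact_operator smulG smulH A \<longleftrightarrow>
    A \<in> bounded_ops smulG smulH \<and> compact (closure (A ` cball 0 1))"

text \<open>
  The coarsest topology on the set of bounded operators for which all the functions
  \<open>\<lambda>T. ip (T x) y\<close> are continuous.
\<close>

definition weak_operator_topology ::
  "('k \<Rightarrow> 'h::real_normed_vector \<Rightarrow> 'h) \<Rightarrow> ('h \<Rightarrow> 'h \<Rightarrow> 'k::topological_space) \<Rightarrow> ('h \<Rightarrow> 'h) topology"
where
  "weak_operator_topology smul ip =
    topology_generated_by {{T \<in> bounded_ops smul smul. ip (T x) y \<in> U} |x y U. open U}"

definition invariant_ops ::
  "('k \<Rightarrow> 'h::real_normed_vector \<Rightarrow> 'h) \<Rightarrow> 'h set \<Rightarrow> ('h \<Rightarrow> 'h) set" where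
  "invariant_ops smul Y = {T \<in> bounded_ops smul smul. T ` Y \<subseteq> Y}"

definition weakly_full ::
  "('k \<Rightarrow> 'h::real_normed_vector \<Rightarrow> 'h) \<Rightarrow> ('h \<Rightarrow> 'h \<Rightarrow> 'k::topological_space)
    \<Rightarrow> ('h \<Rightarrow> 'h) set \<Rightarrow> bool" where
  "weakly_full smul ip \<A> \<longleftrightarrow>
    (\<forall>T\<in>\<A>. \<forall>S\<in>bounded_ops smul smul.
      S \<circ> T = id \<and> T \<circ> S = id \<longrightarrow> S \<in> weak_operator_topology smul ip closure_of \<A>)"

section \<open>Kolmogorov widths and lacunary operator ranges\<close>

definition kolmogorov_width ::
  "('k::field \<Rightarrow> 'h::real_normed_vector \<Rightarrow> 'h) \<Rightarrow> nat \<Rightarrow> 'h set \<Rightarrow> real" where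
  "kolmogorov_width smul n K =
    (INF X\<in>{X. subspace_of_dim smul n X}. SUP x\<in>K. INF z\<in>X. norm (x - z))"

definition lacunary :: "(nat \<Rightarrow> real) \<Rightarrow> bool" where
  "lacunary a \<longleftrightarrow> (\<forall>n. a n > 0) \<and> decseq a \<and> a \<longlonglongrightarrow> 0 \<and>
    liminf (\<lambda>n. ereal (a (Suc n) / a n)) = 0"

definition generating_ellipsoid ::
  "('k::field \<Rightarrow> 'g::real_normed_vector \<Rightarrow> 'g) \<Rightarrow> ('k \<Rightarrow> 'h::real_normed_vector \<Rightarrow> 'h)
    \<Rightarrow> 'h set \<Rightarrow> 'h set \<Rightarrow> bool" where
  "generating_ellipsoid smulG smulH Y K \<longleftrightarrow>
    (\<exists>A. compact_operator smulG smulH A \<and> \<not> finite_dim smulH (range A) \<and>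
      Y = range A \<and> K = A ` cball 0 1)"

text \<open>
  The auxiliary space is the one carried by \<open>smulG\<close>. Separable infinite-dimensional Hilbert
  spaces over the same scalars are isometrically isomorphic, so all of them yield the same
  generating ellipsoids.
\<close>

definition lacunary_range ::
  "('k::field \<Rightarrow> 'g::real_normed_vector \<Rightarrow> 'g) \<Rightarrow> ('k \<Rightarrow> 'h::real_normed_vector \<Rightarrow> 'h)
    \<Rightarrow> 'h set \<Rightarrow> bool" where
  "lacunary_range smulG smulH Y \<longleftrightarrow>
    (\<exists>K. generating_ellipsoid smulG smulH Y K \<and> lacunary (\<lambda>n. kolmogorov_width smulH n K))"

end

theory Submission
  imports Defs
begin

text \<open>
  Write \<open>A = \<Sum> a\<^sub>n \<langle>\<cdot>, g\<^sub>n\<rangle> e\<^sub>n\<close> with orthonormal \<open>g\<^sub>n\<close>, \<open>e\<^sub>n\<close> and decreasing \<open>a\<^sub>n\<close>; then \<open>a\<^sub>n\<close> is the \<open>n\<close>-th width of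
  the ellipsoid. Let \<open>M\<close> be the closure of \<open>Y\<close>. The weak operator closure of \<open>\<A>(Y)\<close> consists of all bounded
  operators leaving \<open>M\<close> invariant, so weak fullness says that \<open>T\<^sup>-\<^sup>1 M \<subseteq> M\<close> for every invertible \<open>T \<in> \<A>(Y)\<close>.
  If \<open>M\<close> has finite codimension, this follows by counting dimensions in the quotient by \<open>M\<close>. If it has
  infinite codimension and the ratios \<open>a\<^sub>n\<^sub>+\<^sub>1 / a\<^sub>n\<close> are bounded below, a bilateral shift acting as
  \<open>e\<^sub>n \<mapsto> e\<^sub>n\<^sub>+\<^sub>1\<close> on \<open>M\<close> is a counterexample. Conversely, if \<open>T\<^sup>-\<^sup>1 y \<notin> M\<close> for some \<open>y \<in> Y\<close>, then a multiple of the
  ellipsoid contains a ball of radius proportional to \<open>a\<^sub>n\<close> in an \<open>(n + 2)\<close>-dimensional space, which bounds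
  \<open>a\<^sub>n\<^sub>+\<^sub>1 / a\<^sub>n\<close> from below.
\<close>

section \<open>Homogeneous linear systems\<close>

text \<open>Gaussian elimination, one equation per induction step. Its use is to find, in a span of
  more vectors than there are conditions, a combination satisfying prescribed orthogonality
  relations.\<close>

lemma homogeneous_system_nontrivial_solution:
  fixes f :: "'i \<Rightarrow> 'j \<Rightarrow> 'k::field"
  assumes "finite I" "finite J" "card I < card J"
  shows "\<exists>c. (\<exists>j\<in>J. c j \<noteq> 0) \<and> (\<forall>i\<in>I. (\<Sum>j\<in>J. c j * f i j) = 0)"
  using assms
proof (induction I arbitrary: J f rule: finite_induct)
  case empty
  then obtain j where "j \<in> J" by fastforce
  then show ?case by (intro exI[of _ "\<lambda>_. 1"]) auto
next
  case (insert i I)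
  show ?case
  proof (cases "\<forall>j\<in>J. f i j = 0")
    case True
    have "card I < card J" using insert by simp
    from insert.IH[OF insert.prems(1) this, of f] obtain c
      where "\<exists>j\<in>J. c j \<noteq> 0" "\<forall>i\<in>I. (\<Sum>j\<in>J. c j * f i j) = 0" by blast
    with True show ?thesis by (intro exI[of _ c]) auto
  next
    case False
    then obtain p where p: "p \<in> J" "f i p \<noteq> 0" by blast
    define J' where "J' = J - {p}"
    have J: "J = insert p J'" "p \<notin> J'" "finite J'" using p insert.prems by (auto simp: J'_def)
    have "card I < card J'" using insert.prems insert.hyps p by (simp add: J'_def)
    from insert.IH[OF J(3) this, of "\<lambda>k j. f k j - f i j / f i p * f k p"] obtain c
      where c: "\<exists>j\<in>J'. c j \<noteq> 0"
        "\<forall>k\<in>I. (\<Sum>j\<in>J'. c j * (f k j - f i j / f i p * f k p)) = 0" by blast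
    \<comment> \<open>Equation \<open>i\<close> solved for the pivot unknown: its value must be
      \<open>- s\<close>. Substituting it into the other equations gives exactly the reduced system
      treated by the induction hypothesis.\<close>
    define s where "s = (\<Sum>j\<in>J'. c j * f i j / f i p)"
    define d where "d = c(p := - s)"
    have sum_d: "(\<Sum>j\<in>J. d j * f k j) = (\<Sum>j\<in>J'. c j * f k j) - s * f k p" for k
    proof -
      have "(\<Sum>j\<in>J'. d j * f k j) = (\<Sum>j\<in>J'. c j * f k j)"
        using J by (intro sum.cong) (auto simp: d_def)
      then show ?thesis using J by (simp add: d_def)
    qed
    have "(\<Sum>j\<in>J. d j * f k j) = 0" if "k \<in> I" for k
    proof -
      have "(\<Sum>j\<in>J'. c j * (f k j - f i j / f i p * f k p)) = (\<Sum>j\<in>J'. c j * f k j) - s * f k p"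
        by (simp add: s_def algebra_simps sum_subtractf sum_distrib_left sum_distrib_right)
      with c(2) that sum_d show ?thesis by simp
    qed
    moreover have "(\<Sum>j\<in>J. d j * f i j) = 0"
      using p by (simp add: sum_d s_def sum_divide_distrib[symmetric])
    moreover have "\<exists>j\<in>J. d j \<noteq> 0" using c(1) J by (auto simp: d_def)
    ultimately show ?thesis by (intro exI[of _ d]) auto
  qed
qed

text \<open>Course-of-values recursion in which the next term depends only on the set of earlier
  terms. This is the form needed to choose orthonormal vectors one after another.\<close>

lemma ex_seq_of_initial_image:
  fixes h :: "'a set \<Rightarrow> 'a"
  shows "\<exists>f. \<forall>n::nat. f n = h (f ` {..<n})"
proof -
  \<comment> \<open>The recursion builds the sets of earlier values; the sequence itself is read off
    afterwards.\<close>
  define B where "B = rec_nat {} (\<lambda>_ X. insert (h X) X)"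
  define f where "f n = h (B n)" for n
  have "B n = f ` {..<n}" for n
    by (induction n) (auto simp: B_def f_def lessThan_Suc)
  then have "f n = h (f ` {..<n})" for n by (subst f_def) (rule arg_cong)
  then show ?thesis by blast
qed

section \<open>Hilbert spaces\<close>

lemma sconj_zero [simp]: "sconj (0::'a::hilbert_scalar) = 0"
  using sconj_add[of "0::'a" 0] by simp

lemma mult_sconj_of_real: "x * sconj x = of_real ((norm x)\<^sup>2)" for x :: "'a::hilbert_scalar"
  by (simp add: mult_sconj of_real_def)

lemma norm_sconj [simp]: "norm (sconj x) = norm x" for x :: "'a::hilbert_scalar"
proof (cases "x = 0")
  case False
  have "norm (x * sconj x) = (norm x)\<^sup>2"
    unfolding mult_sconj_of_real by (simp del: of_real_power)
  with False show ?thesis by (simp add: norm_mult power2_eq_square)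
qed simp

lemma sconj_of_real [simp]: "sconj (of_real r :: 'a::hilbert_scalar) = of_real r"
proof (cases "r = 0")
  case False
  have "of_real r * sconj (of_real r :: 'a) = of_real r * of_real r"
    unfolding mult_sconj_of_real by (simp add: power2_eq_square)
  with False show ?thesis by simp
qed simp

lemma sconj_eq_0_iff [simp]: "sconj x = 0 \<longleftrightarrow> x = 0" for x :: "'a::hilbert_scalar"
  by (metis norm_eq_zero norm_sconj)

context hilbert_space
begin

definition orthonormal :: "(nat \<Rightarrow> 'h) \<Rightarrow> bool" where
  "orthonormal u \<longleftrightarrow> (\<forall>i j. ip (u i) (u j) = (if i = j then 1 else 0))"

lemma ip_sconj_eq_0: "ip x y = 0 \<longleftrightarrow> ip y x = 0"
  by (subst ip_sconj) simp

lemma ip_add_right: "ip x (y + z) = ip x y + ip x z"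
  by (metis ip_add_left ip_sconj sconj_add)

lemma ip_smul_right: "ip x (smul c y) = sconj c * ip x y"
  by (metis ip_smul_left ip_sconj sconj_mult)

lemma ip_zero [simp]: "ip 0 x = 0" "ip x 0 = 0"
  using ip_smul_left[of 0 0 x] ip_smul_right[of x 0 0] by auto

lemma ip_minus_left: "ip (- x) y = - ip x y"
  using ip_add_left[of x "- x" y] by (simp add: eq_neg_iff_add_eq_0 add.commute)

lemma ip_diff_left: "ip (x - y) z = ip x z - ip y z"
  using ip_add_left[of x "- y" z] by (simp add: ip_minus_left)

lemma ip_minus_right: "ip x (- y) = - ip x y"
  using ip_add_right[of x y "- y"] by (simp add: eq_neg_iff_add_eq_0 add.commute)

lemma ip_diff_right: "ip x (y - z) = ip x y - ip x z"
  using ip_add_right[of x y "- z"] by (simp add: ip_minus_right)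

lemmas ip_simps = ip_add_left ip_add_right ip_diff_left ip_diff_right ip_minus_left ip_minus_right
  ip_smul_left ip_smul_right

lemma ip_scaleR_left: "ip (r *\<^sub>R x) y = r *\<^sub>R ip x y"
  by (metis ip_smul_left scaleR_conv_of_real smul_of_real)

lemma ip_sum_left: "ip (\<Sum>i\<in>I. f i) y = (\<Sum>i\<in>I. ip (f i) y)"
  by (induction I rule: infinite_finite_induct) (simp_all add: ip_add_left)

lemma ip_self_eq_0 [simp]: "ip x x = 0 \<longleftrightarrow> x = 0"
  by (simp add: ip_norm)

lemma norm_smul: "norm (smul c x) = norm c * norm x"
proof -
  have "of_real ((norm (smul c x))\<^sup>2) = c * sconj c * (ip x x)"
    unfolding ip_norm[symmetric] by (simp add: ip_smul_left ip_smul_right)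
  also have "\<dots> = of_real ((norm c * norm x)\<^sup>2)"
    by (simp add: mult_sconj_of_real ip_norm power_mult_distrib)
  finally have "(norm (smul c x))\<^sup>2 = (norm c * norm x)\<^sup>2" by (simp only: of_real_eq_iff)
  then show ?thesis by simp
qed

lemma pythagoras: "ip x y = 0 \<Longrightarrow> (norm (x + y))\<^sup>2 = (norm x)\<^sup>2 + (norm y)\<^sup>2"
proof -
  assume xy: "ip x y = 0"
  then have "ip y x = 0" using ip_sconj_eq_0 by blast
  with xy have "ip (x + y) (x + y) = ip x x + ip y y" by (simp add: ip_simps)
  then have "of_real ((norm (x + y))\<^sup>2) = (of_real ((norm x)\<^sup>2 + (norm y)\<^sup>2) :: 'k)"
    by (simp add: ip_norm)
  then show ?thesis by (simp only: of_real_eq_iff)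
qed

lemma parallelogram: "(norm (x + y))\<^sup>2 + (norm (x - y))\<^sup>2 = 2 * (norm x)\<^sup>2 + 2 * (norm y)\<^sup>2"
  for x y :: 'h
proof -
  have "ip (x + y) (x + y) + ip (x - y) (x - y) = 2 * ip x x + 2 * ip y y" by (simp add: ip_simps)
  then have "of_real ((norm (x + y))\<^sup>2 + (norm (x - y))\<^sup>2)
      = (of_real (2 * (norm x)\<^sup>2 + 2 * (norm y)\<^sup>2) :: 'k)"
    by (simp add: ip_norm)
  then show ?thesis by (simp only: of_real_eq_iff)
qed

lemma cauchy_schwarz: "norm (ip x y) \<le> norm x * norm y"
proof (cases "y = 0")
  case False
  \<comment> \<open>The coefficient of the orthogonal projection of \<open>x\<close> onto the line
    through \<open>y\<close>.\<close>
  define c where "c = ip x y / ip y y"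
  have "ip (x - smul c y) (smul c y) = 0"
    using False by (simp add: ip_simps c_def)
  from pythagoras[OF this] have "(norm x)\<^sup>2 = (norm (x - smul c y))\<^sup>2 + (norm (smul c y))\<^sup>2"
    by (simp only: diff_add_cancel)
  then have "(norm (smul c y))\<^sup>2 \<le> (norm x)\<^sup>2" by (metis le_add_same_cancel2 zero_le_power2)
  then have "norm (smul c y) \<le> norm x" by (rule power2_le_imp_le) simp
  moreover have "norm c = norm (ip x y) / (norm y)\<^sup>2"
    by (simp add: c_def norm_divide ip_norm norm_power)
  ultimately show ?thesis using False
    by (simp add: norm_smul field_simps power2_eq_square)
qed simp

lemma bounded_linear_ip_left: "bounded_linear (\<lambda>x. ip x y)"
  by (rule bounded_linear_intro[of _ "norm y"])
    (auto simp: ip_simps ip_scaleR_left cauchy_schwarz)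

lemma smul_scaleR_right: "smul c (r *\<^sub>R x) = r *\<^sub>R smul c x"
  by (metis scale_left_commute smul_of_real)

lemma smul_scaleR_left: "smul (r *\<^sub>R c) x = r *\<^sub>R smul c x"
  by (metis scale_scale scaleR_conv_of_real smul_of_real)

lemma bounded_linear_smul: "bounded_linear (\<lambda>x. smul c x)"
  by (rule bounded_linear_intro[of _ "norm c"])
    (simp_all add: scale_right_distrib norm_smul mult.commute smul_scaleR_right)

lemma bounded_linear_smul_left: "bounded_linear (\<lambda>c. smul c x)"
  by (rule bounded_linear_intro[of _ "norm x"])
    (simp_all add: scale_left_distrib norm_smul smul_scaleR_left mult.commute)

section \<open>Orthonormal sequences, Bessel's inequality and the Riesz-Fischer theorem\<close>

lemma orthonormal_norm: "orthonormal u \<Longrightarrow> norm (u k) = 1"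
proof -
  assume "orthonormal u"
  then have "ip (u k) (u k) = 1" by (simp add: orthonormal_def)
  then have "norm (ip (u k) (u k)) = 1" by simp
  then have "(norm (u k))\<^sup>2 = 1" by (simp add: ip_norm norm_power)
  then show ?thesis by (simp add: power2_eq_1_iff) (use norm_ge_zero[of "u k"] in linarith)
qed

lemma orthonormal_ip: "orthonormal u \<Longrightarrow> ip (u i) (u j) = (if i = j then 1 else 0)"
  by (simp add: orthonormal_def)

lemma orthonormal_comp: "orthonormal u \<Longrightarrow> inj s \<Longrightarrow> orthonormal (u \<circ> s)"
  by (auto simp: orthonormal_def inj_def)

lemma ip_orthonormal_sum:
  "orthonormal u \<Longrightarrow> finite I \<Longrightarrow>
    ip (\<Sum>i\<in>I. smul (c i) (u i)) (u j) = (if j \<in> I then c j else 0)"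
  by (simp add: ip_sum_left ip_smul_left orthonormal_ip if_distrib[of "\<lambda>x. _ * x"] cong: if_cong)

lemma norm_orthonormal_sum:
  assumes "orthonormal u" "finite I"
  shows "(norm (\<Sum>i\<in>I. smul (c i) (u i)))\<^sup>2 = (\<Sum>i\<in>I. (norm (c i))\<^sup>2)"
  using assms(2)
proof (induction I rule: finite_induct)
  case (insert j I)
  have "ip (\<Sum>i\<in>I. smul (c i) (u i)) (smul (c j) (u j)) = 0"
    using insert assms by (simp add: ip_smul_right ip_orthonormal_sum)
  then have "ip (smul (c j) (u j)) (\<Sum>i\<in>I. smul (c i) (u i)) = 0"
    using ip_sconj_eq_0 by blast
  from pythagoras[OF this] insert show ?case
    by (simp add: norm_smul orthonormal_norm[OF assms(1)])
qed simp

text \<open>Pythagoras for the orthogonal projection onto the span of finitely many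
  \<open>u i\<close> and its residual. Dropping either term on the right bounds the other by
  \<open>norm x\<close>.\<close>

lemma orthonormal_residual:
  assumes "orthonormal u" "finite I"
  shows "(norm x)\<^sup>2 = (\<Sum>i\<in>I. (norm (ip x (u i)))\<^sup>2) +
    (norm (x - (\<Sum>i\<in>I. smul (ip x (u i)) (u i))))\<^sup>2"
proof -
  define p where "p = (\<Sum>i\<in>I. smul (ip x (u i)) (u i))"
  have "ip (u i) (x - p) = 0" if "i \<in> I" for i
    using that assms by (subst ip_sconj_eq_0) (simp add: p_def ip_diff_left ip_orthonormal_sum[OF assms])
  then have "ip p (x - p) = 0"
    by (subst p_def) (simp add: ip_sum_left ip_smul_left)
  from pythagoras[OF this] have "(norm x)\<^sup>2 = (norm p)\<^sup>2 + (norm (x - p))\<^sup>2"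
    by (simp only: add_diff_cancel_left' add.commute[of p] diff_add_cancel)
  then show ?thesis unfolding p_def norm_orthonormal_sum[OF assms] .
qed

lemma bessel_finite:
  assumes "orthonormal u" "finite I"
  shows "(\<Sum>i\<in>I. (norm (ip x (u i)))\<^sup>2) \<le> (norm x)\<^sup>2"
  unfolding orthonormal_residual[OF assms, of x] by simp

lemma norm_orthonormal_residual_le:
  assumes "orthonormal u" "finite I"
  shows "norm (x - (\<Sum>i\<in>I. smul (ip x (u i)) (u i))) \<le> norm x"
proof (rule power2_le_imp_le)
  have "0 \<le> (\<Sum>i\<in>I. (norm (ip x (u i)))\<^sup>2)" by (intro sum_nonneg) auto
  then show "(norm (x - (\<Sum>i\<in>I. smul (ip x (u i)) (u i))))\<^sup>2 \<le> (norm x)\<^sup>2"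
    using orthonormal_residual[OF assms, of x] by linarith
qed simp

lemma ip_span_eq_0: "y \<in> span X \<Longrightarrow> (\<And>b. b \<in> X \<Longrightarrow> ip z b = 0) \<Longrightarrow> ip z y = 0"
  by (induction rule: span_induct_alt) (simp_all add: ip_simps)

lemma orthonormal_subspace_of_dim:
  assumes "orthonormal u"
  shows "subspace_of_dim smul n (span (u ` {..<n}))"
proof -
  have inj: "inj_on u I" for I
    by (rule inj_onI) (metis assms orthonormal_ip zero_neq_one)
  have "independent (u ` {..<n})"
  proof
    assume "dependent (u ` {..<n})"
    then obtain c v where c: "(\<Sum>v\<in>u ` {..<n}. smul (c v) v) = 0" and v: "v \<in> u ` {..<n}" "c v \<noteq> 0"
      by (auto simp: dependent_finite)
    from v obtain k where k: "v = u k" "k < n" by auto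
    have "(\<Sum>v\<in>u ` {..<n}. smul (c v) v) = (\<Sum>i<n. smul (c (u i)) (u i))"
      by (simp add: sum.reindex[OF inj])
    then have "ip (\<Sum>i<n. smul (c (u i)) (u i)) (u k) = 0" using c by simp
    with ip_orthonormal_sum[OF assms finite_lessThan, of "\<lambda>i. c (u i)" n k] k v show False by simp
  qed
  then show ?thesis
    unfolding subspace_of_dim_def by (intro exI[of _ "u ` {..<n}"]) (simp add: card_image[OF inj])
qed

lemma bessel_summable:
  assumes "orthonormal u"
  shows "summable (\<lambda>i. (norm (ip x (u i)))\<^sup>2)" "(\<Sum>i. (norm (ip x (u i)))\<^sup>2) \<le> (norm x)\<^sup>2"
proof -
  show "summable (\<lambda>i. (norm (ip x (u i)))\<^sup>2)"
    by (rule summableI_nonneg_bounded[of _ "(norm x)\<^sup>2"]) (auto intro: bessel_finite assms)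
  then show "(\<Sum>i. (norm (ip x (u i)))\<^sup>2) \<le> (norm x)\<^sup>2"
    by (rule suminf_le_const) (auto intro: bessel_finite assms)
qed

text \<open>Squared norms of blocks of the vector series equal blocks of the scalar series, so the
  Cauchy criterion transfers and completeness gives the limit. The other two claims pass to the
  limit by continuity.\<close>

lemma riesz_fischer:
  assumes u: "orthonormal u" and c: "summable (\<lambda>i. (norm (c i))\<^sup>2)"
  shows "summable (\<lambda>i. smul (c i) (u i))"
    and "(norm (\<Sum>i. smul (c i) (u i)))\<^sup>2 = (\<Sum>i. (norm (c i))\<^sup>2)"
    and "ip (\<Sum>i. smul (c i) (u i)) (u j) = c j"
proof -
  show s: "summable (\<lambda>i. smul (c i) (u i))"
    unfolding summable_Cauchy
  proof (intro allI impI)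
    fix r :: real assume "r > 0"
    then have "r\<^sup>2 > 0" by simp
    with c obtain N where N: "\<And>m n. m \<ge> N \<Longrightarrow> norm (\<Sum>i=m..<n. (norm (c i))\<^sup>2) < r\<^sup>2"
      unfolding summable_Cauchy by blast
    have "norm (\<Sum>i=m..<n. smul (c i) (u i)) < r" if "m \<ge> N" for m n
    proof (rule power2_less_imp_less)
      show "(norm (\<Sum>i=m..<n. smul (c i) (u i)))\<^sup>2 < r\<^sup>2"
        unfolding norm_orthonormal_sum[OF u finite_atLeastLessThan] using N[OF that, of n]
        by (simp add: sum_nonneg)
    qed (use \<open>r > 0\<close> in simp)
    then show "\<exists>N. \<forall>m\<ge>N. \<forall>n. norm (\<Sum>i=m..<n. smul (c i) (u i)) < r" by blast
  qed
  have "(\<lambda>n. (norm (\<Sum>i<n. smul (c i) (u i)))\<^sup>2) \<longlonglongrightarrow> (norm (\<Sum>i. smul (c i) (u i)))\<^sup>2"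
    using summable_LIMSEQ[OF s] by (intro tendsto_intros)
  moreover have "(\<lambda>n. (norm (\<Sum>i<n. smul (c i) (u i)))\<^sup>2) \<longlonglongrightarrow> (\<Sum>i. (norm (c i))\<^sup>2)"
    unfolding norm_orthonormal_sum[OF u finite_lessThan] by (rule summable_LIMSEQ[OF c])
  ultimately show "(norm (\<Sum>i. smul (c i) (u i)))\<^sup>2 = (\<Sum>i. (norm (c i))\<^sup>2)"
    by (rule LIMSEQ_unique)
  have "(\<lambda>i. ip (smul (c i) (u i)) (u j)) sums ip (\<Sum>i. smul (c i) (u i)) (u j)"
    by (rule bounded_linear.sums[OF bounded_linear_ip_left summable_sums[OF s]])
  moreover have "(\<lambda>i. ip (smul (c i) (u i)) (u j)) = (\<lambda>i. if i = j then c i else 0)"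
    using u by (auto simp: ip_smul_left orthonormal_ip)
  ultimately have "(\<lambda>i. if i = j then c i else 0) sums ip (\<Sum>i. smul (c i) (u i)) (u j)" by simp
  then show "ip (\<Sum>i. smul (c i) (u i)) (u j) = c j"
    using sums_single[of j c] sums_unique2 by blast
qed

text \<open>For orthonormal \<open>u\<close> and \<open>v\<close> this is the partial isometry
  taking \<open>u i\<close> to \<open>v i\<close> and vanishing on the orthogonal complement of all
  \<open>u i\<close>. In particular \<open>transport u u\<close> is the orthogonal projection onto
  the closed span of \<open>u\<close>.\<close>

definition transport :: "(nat \<Rightarrow> 'h) \<Rightarrow> (nat \<Rightarrow> 'h) \<Rightarrow> 'h \<Rightarrow> 'h" where
  "transport u v x = (\<Sum>i. smul (ip x (u i)) (v i))"

context
  fixes u v assumes u: "orthonormal u" and v: "orthonormal v"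
begin

lemma transport_sums: "(\<lambda>i. smul (ip x (u i)) (v i)) sums transport u v x"
  unfolding transport_def by (intro summable_sums riesz_fischer(1) v bessel_summable u)

lemma norm_transport_le: "norm (transport u v x) \<le> norm x"
proof -
  have "(norm (transport u v x))\<^sup>2 \<le> (norm x)\<^sup>2"
    unfolding transport_def using u v by (simp add: riesz_fischer(2) bessel_summable)
  then show ?thesis by (rule power2_le_imp_le) simp
qed

lemma transport_bounded_ops: "transport u v \<in> bounded_ops smul smul"
proof -
  have add: "transport u v (x + y) = transport u v x + transport u v y" for x y
    using sums_add[OF transport_sums[of x] transport_sums[of y]] transport_sums[of "x + y"]
    by (auto simp: ip_add_left scale_left_distrib intro: sums_unique2)
  have smul: "transport u v (smul c x) = smul c (transport u v x)" for c x
    using bounded_linear.sums[OF bounded_linear_smul transport_sums, of c x]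
      transport_sums[of "smul c x"]
    by (auto simp: ip_smul_left intro: sums_unique2)
  have "bounded_linear (transport u v)"
    by (rule bounded_linear_intro[of _ 1])
      (use add smul[of "of_real _"] norm_transport_le in \<open>auto simp: smul_of_real\<close>)
  with smul show ?thesis by (simp add: bounded_ops_def)
qed

lemma transport_basis: "transport u v (u k) = v k"
proof -
  have "(\<lambda>i. smul (ip (u k) (u i)) (v i)) = (\<lambda>i. if i = k then v i else 0)"
    using u by (auto simp: orthonormal_ip)
  with transport_sums[of "u k"] have "(\<lambda>i. if i = k then v i else 0) sums transport u v (u k)"
    by simp
  then show ?thesis using sums_single[of k v] sums_unique2 by blast
qed

lemma ip_transport: "ip (transport u v x) (v k) = ip x (u k)"
  unfolding transport_def by (rule riesz_fischer(3)[OF v bessel_summable(1)[OF u]])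

end

lemma transport_orthogonal: "(\<And>i. ip x (u i) = 0) \<Longrightarrow> transport u v x = 0"
  by (simp add: transport_def)

text \<open>Gram-Schmidt by induction on \<open>X\<close>: project \<open>x\<close> and the new
  vector \<open>v\<close> onto the old span, then correct along the residual \<open>u\<close> of
  \<open>v\<close>. If \<open>v\<close> already lies in the old span, \<open>u\<close> is zero and
  so is the correction.\<close>

lemma finite_orthogonal_projection:
  assumes "finite X"
  shows "\<exists>p\<in>span X. \<forall>v\<in>X. ip (x - p) v = 0"
  using assms
proof (induction X arbitrary: x rule: finite_induct)
  case empty
  show ?case by (auto intro: span_zero)
next
  case (insert v X)
  from insert.IH[of x] obtain p where p: "p \<in> span X" "\<forall>w\<in>X. ip (x - p) w = 0" by blast
  from insert.IH[of v] obtain q where q: "q \<in> span X" "\<forall>w\<in>X. ip (v - q) w = 0" by blast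
  define u where "u = v - q"
  define c where "c = ip (x - p) u / ip u u"
  have sub: "span X \<subseteq> span (insert v X)" by (intro span_mono) auto
  have u: "u \<in> span (insert v X)"
    unfolding u_def using q sub by (intro span_diff) (auto intro: span_base)
  have "ip (x - p - smul c u) w = 0" if "w \<in> X" for w
    using p q that by (simp add: ip_simps u_def)
  moreover have qX: "ip z q = 0" if "\<forall>w\<in>X. ip z w = 0" for z
    using ip_span_eq_0 that q(1) by blast
  moreover have "ip (x - p - smul c u) u = 0"
    by (cases "u = 0") (simp_all add: ip_diff_left ip_smul_left c_def)
  ultimately have "ip (x - p - smul c u) v = 0" "\<forall>w\<in>X. ip (x - p - smul c u) w = 0"
    by (auto simp: u_def ip_diff_right)
  moreover have "p + smul c u \<in> span (insert v X)" using p u sub by (intro span_add span_scale) auto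
  ultimately show ?case by (intro bexI[of _ "p + smul c u"]) (auto simp: diff_diff_add)
qed

end

section \<open>The Schmidt expansion of a compact operator\<close>

locale hilbert_space_pair =
  G: hilbert_space smulG ipG + H: hilbert_space smulH ipH
  for smulG :: "'k::hilbert_scalar \<Rightarrow> 'g::banach \<Rightarrow> 'g" and ipG
    and smulH :: "'k \<Rightarrow> 'h::banach \<Rightarrow> 'h" and ipH
begin

text \<open>The norm of \<open>A\<close> on the orthogonal complement of \<open>X\<close> is
  attained and positive. Compactness makes the images of a maximizing sequence converge along a
  subsequence; maximality then makes the vectors themselves converge.\<close>

lemma ex_norm_attaining_orthogonal:
  assumes A: "compact_operator smulG smulH A" and inf: "\<not> finite_dim smulH (range A)"
    and X: "finite X"
  shows "\<exists>v. norm v = 1 \<and> (\<forall>b\<in>X. ipG v b = 0) \<and> 0 < norm (A v) \<and>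
    (\<forall>x. (\<forall>b\<in>X. ipG x b = 0) \<longrightarrow> norm (A x) \<le> norm (A v) * norm x)"
proof -
  have bl: "bounded_linear A" and hom: "\<And>c x. A (smulG c x) = smulH c (A x)"
    using A by (auto simp: compact_operator_def bounded_ops_def)
  interpret A: bounded_linear A by (rule bl)
  define D where "D = {x. \<forall>b\<in>X. ipG x b = 0}"
  \<comment> \<open>If \<open>A\<close> vanished on \<open>D\<close>, every \<open>A x\<close> would
    equal the image of the projection of \<open>x\<close> onto the span of \<open>X\<close>, and the
    range would be finite-dimensional.\<close>
  have "\<exists>x\<in>D. A x \<noteq> 0"
  proof (rule ccontr)
    assume 0: "\<not> (\<exists>x\<in>D. A x \<noteq> 0)"
    have "H.span (A ` X) = range A"
    proof (intro set_eqI iffI)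
      fix y assume "y \<in> H.span (A ` X)"
      then show "y \<in> range A"
      proof (induction rule: H.span_induct_alt)
        case base
        show ?case using A.zero by (metis rangeI)
      next
        case (step c x y)
        then show ?case by (auto simp: hom[symmetric] A.add[symmetric])
      qed
    next
      fix y assume "y \<in> range A"
      then obtain x where y: "y = A x" by auto
      from G.finite_orthogonal_projection[OF X, of x] obtain p
        where p: "p \<in> G.span X" "\<forall>v\<in>X. ipG (x - p) v = 0" by blast
      then have "A (x - p) = 0" using 0 by (auto simp: D_def)
      then have "y = A p" by (simp add: A.diff y)
      also from p(1) have "A p \<in> H.span (A ` X)"
      proof (induction rule: G.span_induct_alt)
        case base
        show ?case by (simp add: A.zero H.span_zero)
      next
        case (step c x y)
        then show ?case
          by (auto simp: hom A.add intro!: H.span_add H.span_scale intro: H.span_base)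
      qed
      finally show "y \<in> H.span (A ` X)" .
    qed
    with X inf show False by (auto simp: finite_dim_def)
  qed
  then obtain z where z: "z \<in> D" "A z \<noteq> 0" by blast
  then have z0: "z \<noteq> 0" using A.zero by auto
  have D_scaleR: "r *\<^sub>R x \<in> D" if "x \<in> D" for r x
    using that by (auto simp: D_def G.ip_scaleR_left)
  define N where "N = (\<lambda>x. norm (A x)) ` (D \<inter> sphere 0 1)"
  define a where "a = Sup N"
  obtain K where K: "\<And>x. norm (A x) \<le> norm x * K" using A.bounded by blast
  have bdd: "bdd_above N"
  proof (rule bdd_aboveI)
    fix r assume "r \<in> N"
    then obtain x where "r = norm (A x)" "norm x = 1" by (auto simp: N_def)
    with K[of x] show "r \<le> K" by simp
  qed
  have le_a: "norm (A x) \<le> a * norm x" if "x \<in> D" for x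
  proof (cases "x = 0")
    case False
    have "norm (A ((1 / norm x) *\<^sub>R x)) \<le> a"
      unfolding a_def using False D_scaleR[OF that]
      by (intro cSup_upper bdd) (auto simp: N_def)
    with False show ?thesis by (simp add: A.scaleR field_simps)
  qed (simp add: A.zero)
  have "0 < norm (A z)" using z by simp
  also have "norm (A z) \<le> a * norm z" by (rule le_a[OF z(1)])
  finally have a: "a > 0" using z0 by (simp add: zero_less_mult_iff)
  have "N \<noteq> {}" using z z0 D_scaleR[of z "1 / norm z"] by (auto simp: N_def)
  have "\<forall>n. \<exists>x. x \<in> D \<and> norm x = 1 \<and> a - 1 / Suc n < norm (A x)"
  proof
    fix n
    from less_cSupD[OF \<open>N \<noteq> {}\<close>, of "a - 1 / Suc n"] obtain s where "s \<in> N" "a - 1 / Suc n < s"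
      by (auto simp: a_def)
    then show "\<exists>x. x \<in> D \<and> norm x = 1 \<and> a - 1 / Suc n < norm (A x)" by (auto simp: N_def)
  qed
  then obtain x where x: "\<And>n. x n \<in> D" "\<And>n. norm (x n) = 1" "\<And>n. a - 1 / Suc n < norm (A (x n))"
    by metis
  have "compact (closure (A ` cball 0 1))" using A by (simp add: compact_operator_def)
  moreover have "\<forall>n. A (x n) \<in> closure (A ` cball 0 1)"
    using x(2) by (intro allI subsetD[OF closure_subset]) auto
  ultimately obtain h r where r: "strict_mono r" "((\<lambda>n. A (x n)) \<circ> r) \<longlonglongrightarrow> h"
    unfolding compact_def by (auto dest!: spec[where x = "\<lambda>n. A (x n)"])
  define y where "y = x \<circ> r"
  have y: "y n \<in> D" "norm (y n) = 1" for n using x by (simp_all add: y_def)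
  have lim: "(\<lambda>n. A (y n)) \<longlonglongrightarrow> h" using r(2) by (simp add: y_def o_def)
  have "(\<lambda>n. norm (A (x n))) \<longlonglongrightarrow> a"
  proof (rule tendsto_sandwich)
    show "\<forall>\<^sub>F n in sequentially. a - 1 / Suc n \<le> norm (A (x n))"
      using x(3) by (intro always_eventually allI less_imp_le)
    show "\<forall>\<^sub>F n in sequentially. norm (A (x n)) \<le> a"
      using le_a[OF x(1)] x(2) by (intro always_eventually allI) (metis mult.right_neutral)
    show "(\<lambda>n. a - 1 / Suc n) \<longlonglongrightarrow> a"
      using tendsto_diff[OF tendsto_const LIMSEQ_inverse_real_of_nat, of a] by (simp add: inverse_eq_divide)
  qed simp
  from LIMSEQ_subseq_LIMSEQ[OF this r(1)] have "(\<lambda>n. norm (A (y n))) \<longlonglongrightarrow> a"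
    by (simp add: y_def o_def)
  with tendsto_norm[OF lim] have h: "norm h = a" by (rule LIMSEQ_unique)
  \<comment> \<open>The parallelogram law turns convergence of \<open>A (y n)\<close> to a vector of norm \<open>a\<close> into convergence
    of \<open>y n\<close>, because \<open>norm (A (y m + y n))\<close> is almost \<open>2 * a\<close>.\<close>
  have "Cauchy y"
  proof (rule metric_CauchyI)
    fix e :: real assume e: "e > 0"
    \<comment> \<open>Two errors of size \<open>d\<close> give
      \<open>norm (y m + y n) > 2 - e\<^sup>2 / 4\<close>. The parallelogram law multiplies this
      deficit by at most 4, so the squared distance stays below \<open>e\<^sup>2\<close>.\<close>
    define d where "d = a * e\<^sup>2 / 8"
    have d: "d > 0" using a e by (simp add: d_def)
    then obtain M where M: "\<And>n. n \<ge> M \<Longrightarrow> norm (A (y n) - h) < d"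
      using LIMSEQ_D[OF lim] by blast
    have "dist (y m) (y n) < e" if "m \<ge> M" "n \<ge> M" for m n
    proof -
      have "2 * a = norm (h + h)" using h by (simp add: scaleR_2[symmetric])
      also have "\<dots> = norm (A (y m + y n) - (A (y m) - h) - (A (y n) - h))"
        by (simp add: A.add algebra_simps)
      also have "\<dots> \<le> norm (A (y m + y n)) + norm (A (y m) - h) + norm (A (y n) - h)"
        by (metis norm_triangle_ineq4 add_right_mono order_trans)
      also have "\<dots> < norm (A (y m + y n)) + d + d"
        using M[OF that(1)] M[OF that(2)] by linarith
      also have "norm (A (y m + y n)) \<le> a * norm (y m + y n)"
        using y by (intro le_a) (auto simp: D_def G.ip_add_left)
      finally have "2 * a < a * norm (y m + y n) + a * (e\<^sup>2 / 4)" by (simp add: d_def)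
      then have "a * 2 < a * (norm (y m + y n) + e\<^sup>2 / 4)" by (simp add: algebra_simps)
      then have lt: "2 - e\<^sup>2 / 4 < norm (y m + y n)" using a by simp
      have le: "norm (y m + y n) \<le> 2" using norm_triangle_ineq[of "y m" "y n"] y by simp
      have "(norm (y m + y n))\<^sup>2 + (norm (y m - y n))\<^sup>2 = 4"
        using G.parallelogram[of "y m" "y n"] y by simp
      then have "(norm (y m - y n))\<^sup>2 = (2 - norm (y m + y n)) * (2 + norm (y m + y n))"
        by (simp add: algebra_simps power2_eq_square)
      also have "\<dots> \<le> (2 - norm (y m + y n)) * 4" using le by (intro mult_left_mono) auto
      also have "\<dots> < e\<^sup>2" using lt by simp
      finally show ?thesis using e by (simp add: dist_norm power2_less_imp_less)
    qed
    then show "\<exists>M. \<forall>m\<ge>M. \<forall>n\<ge>M. dist (y m) (y n) < e" by blast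
  qed
  then obtain v where v: "y \<longlonglongrightarrow> v" using Cauchy_convergent convergent_def by blast
  have "norm v = 1" using tendsto_norm[OF v] y by (simp add: LIMSEQ_const_iff)
  moreover have "A v = h" using A.tendsto[OF v] lim LIMSEQ_unique by blast
  moreover have "ipG v b = 0" if "b \<in> X" for b
  proof -
    have "(\<lambda>n. ipG (y n) b) \<longlonglongrightarrow> ipG v b"
      by (rule bounded_linear.tendsto[OF G.bounded_linear_ip_left v])
    with y that show ?thesis by (simp add: D_def LIMSEQ_const_iff)
  qed
  ultimately show ?thesis using a h le_a by (auto simp: D_def intro!: exI[of _ v])
qed

text \<open>First-order optimality: if \<open>A x\<close> had a component along \<open>A v\<close>,
  moving \<open>v\<close> slightly towards \<open>x\<close> would raise \<open>norm (A v)\<close> to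
  first order but \<open>norm v\<close> only to second order. Hence successive maximizers have
  orthogonal images.\<close>

lemma norm_attaining_orthogonal:
  assumes A: "A \<in> bounded_ops smulG smulH"
    and v: "norm v = 1" "\<forall>b\<in>X. ipG v b = 0"
    and max: "\<And>x. \<forall>b\<in>X. ipG x b = 0 \<Longrightarrow> norm (A x) \<le> norm (A v) * norm x"
    and x: "\<forall>b\<in>X. ipG x b = 0" "ipG x v = 0"
  shows "ipH (A x) (A v) = 0"
proof (rule ccontr)
  define c where "c = ipH (A x) (A v)"
  define B where "B = (norm (A v))\<^sup>2 * (norm x)\<^sup>2"
  assume "ipH (A x) (A v) \<noteq> 0"
  then have c: "norm c > 0" by (simp add: c_def)
  have hom: "A (x + smulG k y) = A x + smulH k (A y)" for x y k
    using A by (simp add: bounded_ops_def linear_simps)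
  have key: "2 * e \<le> e\<^sup>2 * B" if e: "e > 0" for e
  proof -
    \<comment> \<open>The factor \<open>sconj c\<close> turns both cross terms into the nonnegative
      real number \<open>e * (norm c)\<^sup>2\<close>.\<close>
    define t where "t = of_real e * sconj c"
    have sc: "sconj t = of_real e * c"
    proof -
      have "sconj (sconj c) = c"
        unfolding c_def using H.ip_sconj by metis
      then show ?thesis by (simp add: t_def sconj_mult)
    qed
    have "ipG v x = 0" using x(2) G.ip_sconj_eq_0 by blast
    then have "ipG v (smulG t x) = 0" by (simp add: G.ip_smul_right)
    from G.pythagoras[OF this] have nn: "(norm (v + smulG t x))\<^sup>2 = 1 + e\<^sup>2 * (norm c)\<^sup>2 * (norm x)\<^sup>2"
      using v e by (simp add: G.norm_smul t_def norm_mult power_mult_distrib)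
    have "norm (A (v + smulG t x)) \<le> norm (A v) * norm (v + smulG t x)"
      using v x by (intro max) (auto simp: G.ip_add_left G.ip_smul_left)
    then have "(norm (A (v + smulG t x)))\<^sup>2 \<le> (norm (A v) * norm (v + smulG t x))\<^sup>2"
      by (intro power_mono) auto
    also have "\<dots> = (norm (A v))\<^sup>2 + e\<^sup>2 * (norm c)\<^sup>2 * B"
      by (simp add: power_mult_distrib nn B_def algebra_simps)
    finally have up: "(norm (A (v + smulG t x)))\<^sup>2 \<le> (norm (A v))\<^sup>2 + e\<^sup>2 * (norm c)\<^sup>2 * B" .
    have "ipH (A v) (A x) = sconj c" unfolding c_def by (rule H.ip_sconj)
    then have "ipH (A v + smulH t (A x)) (A v + smulH t (A x))
        = ipH (A v) (A v) + sconj t * sconj c + t * c + t * sconj t * ipH (A x) (A x)"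
      by (simp add: H.ip_simps c_def algebra_simps)
    also have "sconj t * sconj c = of_real (e * (norm c)\<^sup>2)"
      by (simp add: sc mult_sconj_of_real mult.assoc)
    also have "t * c = of_real (e * (norm c)\<^sup>2)"
      using mult_sconj_of_real[of c] by (simp add: t_def mult.assoc mult.commute[of _ c])
    also have "t * sconj t * ipH (A x) (A x) = of_real ((norm t)\<^sup>2 * (norm (A x))\<^sup>2)"
      by (simp add: mult_sconj_of_real H.ip_norm)
    finally have "of_real ((norm (A v + smulH t (A x)))\<^sup>2) =
      (of_real ((norm (A v))\<^sup>2 + e * (norm c)\<^sup>2 + e * (norm c)\<^sup>2 + (norm t)\<^sup>2 * (norm (A x))\<^sup>2) :: 'k)"
      by (simp add: H.ip_norm)
    then have "(norm (A v + smulH t (A x)))\<^sup>2 =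
      (norm (A v))\<^sup>2 + e * (norm c)\<^sup>2 + e * (norm c)\<^sup>2 + (norm t)\<^sup>2 * (norm (A x))\<^sup>2"
      by (simp only: of_real_eq_iff)
    moreover have "(norm t)\<^sup>2 * (norm (A x))\<^sup>2 \<ge> 0" by simp
    ultimately have "2 * (e * (norm c)\<^sup>2) \<le> e\<^sup>2 * (norm c)\<^sup>2 * B"
      using up unfolding hom by linarith
    then have "(norm c)\<^sup>2 * (2 * e) \<le> (norm c)\<^sup>2 * (e\<^sup>2 * B)" by (simp add: algebra_simps)
    then show ?thesis using c by (simp add: mult_le_cancel_left)
  qed
  have B: "B \<ge> 0" by (simp add: B_def)
  \<comment> \<open>Small enough that \<open>e * B \<le> 1\<close>, while \<open>key\<close> demands
    \<open>2 \<le> e * B\<close>.\<close>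
  define e where "e = 1 / (B + 1)"
  have e: "e > 0" "e * B \<le> 1" using B by (auto simp: e_def)
  from key[OF e(1)] have "e * 2 \<le> e * (e * B)" by (simp add: power2_eq_square algebra_simps)
  with e show False by simp
qed

end

text \<open>A singular value decomposition in which \<open>a n\<close> are the singular values. The
  last assumption records their extremality: orthogonally to the first \<open>n\<close> vectors
  \<open>g k\<close>, the norm of \<open>A\<close> is at most \<open>a n\<close>. Both the
  convergence of the expansion and the upper bound for the widths come from it.\<close>

locale schmidt_expansion = hilbert_space_pair smulG ipG smulH ipH
  for smulG :: "'k::hilbert_scalar \<Rightarrow> 'g::banach \<Rightarrow> 'g" and ipG
    and smulH :: "'k \<Rightarrow> 'h::banach \<Rightarrow> 'h" and ipH +
  fixes A :: "'g \<Rightarrow> 'h" and a :: "nat \<Rightarrow> real" and g :: "nat \<Rightarrow> 'g" and e :: "nat \<Rightarrow> 'h"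
  assumes A: "A \<in> bounded_ops smulG smulH"
    and orthonormal_g: "G.orthonormal g"
    and orthonormal_e: "H.orthonormal e"
    and A_g: "A (g n) = a n *\<^sub>R e n"
    and a_pos: "a n > 0"
    and a_decseq: "decseq a"
    and a_lim: "a \<longlonglongrightarrow> 0"
    and norm_A_le: "(\<And>k. k < n \<Longrightarrow> ipG x (g k) = 0) \<Longrightarrow> norm (A x) \<le> a n * norm x"

text \<open>Greedy choice: \<open>g n\<close> attains the norm of \<open>A\<close> on the complement
  of its predecessors. The complements shrink, so the values decrease, and first-order optimality
  makes the images orthogonal.\<close>

lemma (in hilbert_space_pair) ex_schmidt_expansion:
  assumes A: "compact_operator smulG smulH A" and inf: "\<not> finite_dim smulH (range A)"
  shows "\<exists>a g e. schmidt_expansion smulG ipG smulH ipH A a g e"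
proof -
  have bo: "A \<in> bounded_ops smulG smulH" using A by (simp add: compact_operator_def)
  define h where "h X = (SOME v. norm v = 1 \<and> (\<forall>b\<in>X. ipG v b = 0) \<and> 0 < norm (A v) \<and>
    (\<forall>x. (\<forall>b\<in>X. ipG x b = 0) \<longrightarrow> norm (A x) \<le> norm (A v) * norm x))" for X
  obtain g where "\<forall>n::nat. g n = h (g ` {..<n})"
    by (rule exE[OF ex_seq_of_initial_image[of h]]) (rule that)
  then have gh: "g n = h (g ` {..<n})" for n by (rule spec)
  have g: "norm (g n) = 1 \<and> (\<forall>b\<in>g ` {..<n}. ipG (g n) b = 0) \<and> 0 < norm (A (g n)) \<and>
    (\<forall>x. (\<forall>b\<in>g ` {..<n}. ipG x b = 0) \<longrightarrow> norm (A x) \<le> norm (A (g n)) * norm x)" for n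
    unfolding gh[of n] h_def by (rule someI_ex[OF ex_norm_attaining_orthogonal[OF A inf]]) simp
  define a where "a n = norm (A (g n))" for n
  define e where "e n = (1 / a n) *\<^sub>R A (g n)" for n
  have a: "a n > 0" for n using g by (simp add: a_def)
  have Ag: "A (g n) = a n *\<^sub>R e n" for n using a[of n] by (simp add: e_def)
  have max: "norm (A x) \<le> a n * norm x" if "\<And>k. k < n \<Longrightarrow> ipG x (g k) = 0" for x n
    using g[of n] that by (auto simp: a_def)
  have g_less: "ipG (g m) (g n) = 0" if "n < m" for m n using g[of m] that by auto
  have g_orth: "ipG (g m) (g n) = 0" if "n \<noteq> m" for m n
    using that g_less G.ip_sconj_eq_0 by (metis nat_neq_iff)
  have "ipG (g n) (g n) = 1" for n using g[of n] by (simp add: G.ip_norm)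
  with g_orth have on_g: "G.orthonormal g" by (auto simp: G.orthonormal_def)
  have Ag_less: "ipH (A (g m)) (A (g n)) = 0" if "n < m" for m n
    by (rule norm_attaining_orthogonal[OF bo, where X = "g ` {..<n}"])
      (use g[of n] g_less that in auto)
  then have Ag_orth: "ipH (A (g m)) (A (g n)) = 0" if "n \<noteq> m" for m n
    using that H.ip_sconj_eq_0 by (metis nat_neq_iff)
  have "ipH (e m) (e n) = (if m = n then 1 else 0)" for m n
  proof (cases "m = n")
    case True
    have "norm (e n) = 1" using a[of n] by (simp add: e_def) (simp add: a_def)
    then show ?thesis using True by (simp add: H.ip_norm)
  next
    case False
    have *: "e k = smulH (of_real (1 / a k)) (A (g k))" for k
      by (simp only: e_def H.smul_of_real)
    show ?thesis using False Ag_orth[of n m] by (simp add: * H.ip_simps)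
  qed
  then have on_e: "H.orthonormal e" by (auto simp: H.orthonormal_def)
  have dec: "decseq a"
  proof (rule decseq_SucI)
    fix n
    have "norm (A (g (Suc n))) \<le> a n * norm (g (Suc n))" by (intro max g_less) auto
    then show "a (Suc n) \<le> a n" using g[of "Suc n"] by (simp add: a_def)
  qed
  \<comment> \<open>Orthogonal images satisfy \<open>norm (A (g m) - A (g n)) \<ge> a m\<close>. A
    convergent subsequence of images thus forces some \<open>a m\<close> below any \<open>r\<close>,
    and monotonicity carries this to all later terms.\<close>
  have "a \<longlonglongrightarrow> 0"
  proof (rule LIMSEQ_I)
    fix r :: real assume r: "r > 0"
    have "compact (closure (A ` cball 0 1))" using A by (simp add: compact_operator_def)
    moreover have "\<forall>n. A (g n) \<in> closure (A ` cball 0 1)"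
      using g by (intro allI subsetD[OF closure_subset]) auto
    ultimately obtain l s where s: "strict_mono s" "((\<lambda>n. A (g n)) \<circ> s) \<longlonglongrightarrow> l"
      unfolding compact_def by (auto dest!: spec[where x = "\<lambda>n. A (g n)"])
    then have "Cauchy ((\<lambda>n. A (g n)) \<circ> s)" by (intro LIMSEQ_imp_Cauchy)
    from CauchyD[OF this r] obtain M where
      M: "\<And>m n. m \<ge> M \<Longrightarrow> n \<ge> M \<Longrightarrow> norm (A (g (s m)) - A (g (s n))) < r" by auto
    define m n where "m = s M" and "n = s (Suc M)"
    have "m \<noteq> n" using s(1) by (simp add: m_def n_def strict_mono_eq)
    then have "ipH (A (g m)) (- A (g n)) = 0" using Ag_orth by (simp add: H.ip_minus_right)
    from H.pythagoras[OF this] have "(a m)\<^sup>2 \<le> (norm (A (g m) - A (g n)))\<^sup>2" by (simp add: a_def)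
    then have "a m \<le> norm (A (g m) - A (g n))" by (rule power2_le_imp_le) simp
    also have "\<dots> < r" using M[of M "Suc M"] by (simp add: m_def n_def)
    finally have "a m < r" .
    have "norm (a k - 0) < r" if "k \<ge> m" for k
      using decseqD[OF dec that] a[of k] \<open>a m < r\<close> by simp
    then show "\<exists>N. \<forall>k\<ge>N. norm (a k - 0) < r" by blast
  qed
  then have "schmidt_expansion smulG ipG smulH ipH A a g e"
    by unfold_locales (use bo on_g on_e Ag a dec max in auto)
  then show ?thesis by blast
qed

section \<open>Coordinates, widths and lifted operators for a Schmidt expansion\<close>

context schmidt_expansion
begin

lemma bounded_linear_A: "bounded_linear A"
  using A by (simp add: bounded_ops_def)

sublocale A: bounded_linear A
  by (rule bounded_linear_A)

lemma A_smul: "A (smulG c x) = smulH c (A x)"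
  using A by (simp add: bounded_ops_def)

lemma A_sum_g: "A (\<Sum>i\<in>I. smulG (c i) (g i)) = (\<Sum>i\<in>I. smulH (c i) (a i *\<^sub>R e i))"
  by (simp add: A.sum A_smul A_g)

text \<open>The remainder of \<open>x\<close> after \<open>n\<close> coordinates is orthogonal to
  the first \<open>n\<close> vectors \<open>g k\<close>, so its image has norm at most
  \<open>a n * norm x\<close>, which tends to 0.\<close>

lemma A_sums: "(\<lambda>k. smulH (ipG x (g k)) (a k *\<^sub>R e k)) sums A x"
proof -
  define s where "s n = (\<Sum>k<n. smulG (ipG x (g k)) (g k))" for n
  have "norm (A (x - s n)) \<le> a n * norm x" for n
  proof -
    have "norm (A (x - s n)) \<le> a n * norm (x - s n)"
      by (intro norm_A_le) (simp add: s_def G.ip_diff_left G.ip_orthonormal_sum[OF orthonormal_g])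
    also have "\<dots> \<le> a n * norm x"
      unfolding s_def using a_pos[of n]
      by (intro mult_left_mono G.norm_orthonormal_residual_le orthonormal_g) auto
    finally show ?thesis .
  qed
  then have "(\<lambda>n. A (x - s n)) \<longlonglongrightarrow> 0"
    by (intro Lim_null_comparison[OF always_eventually tendsto_mult_left_zero[OF a_lim]]) auto
  from tendsto_diff[OF tendsto_const[of "A x"] this] have "(\<lambda>n. A (s n)) \<longlonglongrightarrow> A x"
    by (simp add: A.diff)
  then show ?thesis by (simp add: sums_def s_def A_sum_g)
qed

lemma A_eqI:
  assumes "\<And>k. ipG x (g k) = ipG y (g k)"
  shows "A x = A y"
  using A_sums[of x] A_sums[of y] assms by (auto intro: sums_unique2)

lemma ip_A_e: "ipH (A x) (e k) = of_real (a k) * ipG x (g k)"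
proof -
  have "(\<lambda>j. ipH (smulH (ipG x (g j)) (a j *\<^sub>R e j)) (e k))
      = (\<lambda>j. if j = k then of_real (a j) * ipG x (g j) else 0)"
    by (auto simp: H.ip_smul_left H.ip_scaleR_left H.orthonormal_ip[OF orthonormal_e]
      scaleR_conv_of_real mult.commute)
  with bounded_linear.sums[OF H.bounded_linear_ip_left A_sums, of x "e k"]
  have "(\<lambda>j. if j = k then of_real (a j) * ipG x (g j) else 0) sums ipH (A x) (e k)" by simp
  then show ?thesis by (rule sums_unique2[OF _ sums_single[of k "\<lambda>j. of_real (a j) * ipG x (g j)"]])
qed

lemma e_in_range: "e k \<in> range A"
proof -
  have "e k = A ((1 / a k) *\<^sub>R g k)" using a_pos[of k] by (simp add: A.scaleR A_g)
  then show ?thesis by (rule range_eqI)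
qed

lemma sum_e_in_range: "(\<Sum>i\<in>I. smulH (c i) (e i)) \<in> range A"
proof (induction I rule: infinite_finite_induct)
  case (insert i I)
  obtain x y where "A x = e i" "A y = (\<Sum>i\<in>I. smulH (c i) (e i))"
    using e_in_range[of i] insert by (metis rangeE)
  then have "A (smulG (c i) x + y) = (\<Sum>i\<in>insert i I. smulH (c i) (e i))"
    using insert by (simp add: A.add A_smul)
  then show ?case by (metis rangeI)
qed (metis A.zero rangeI sum.infinite, metis A.zero rangeI sum.empty)

text \<open>Describes the closure as the fixed space of the projection \<open>transport e e\<close>.
  That space is closed and contains the range; conversely the partial sums of the expansion of a
  fixed vector lie in the range.\<close>

lemma closure_range_iff: "x \<in> closure (range A) \<longleftrightarrow> H.transport e e x = x"
proof
  have bo: "H.transport e e \<in> bounded_ops smulH smulH"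
    by (rule H.transport_bounded_ops[OF orthonormal_e orthonormal_e])
  then have bl: "bounded_linear (H.transport e e)" by (simp add: bounded_ops_def)
  have "H.transport e e (A x) = A x" for x
  proof -
    have "H.transport e e (smulH c (r *\<^sub>R e k)) = smulH c (r *\<^sub>R e k)" for c r k
      using bo by (simp add: bounded_ops_def linear_simps
        H.transport_basis[OF orthonormal_e orthonormal_e])
    with bounded_linear.sums[OF bl A_sums[of x]] A_sums[of x] show ?thesis
      by (auto intro: sums_unique2)
  qed
  then have "range A \<subseteq> {x. H.transport e e x = x}" by auto
  moreover have "closed {x. H.transport e e x = x}"
    by (intro closed_Collect_eq bounded_linear.continuous_on[OF bl] continuous_intros)
  ultimately have "closure (range A) \<subseteq> {x. H.transport e e x = x}" by (rule closure_minimal)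
  then show "x \<in> closure (range A) \<Longrightarrow> H.transport e e x = x" by blast
next
  assume "H.transport e e x = x"
  with H.transport_sums[OF orthonormal_e orthonormal_e, of x]
  have "(\<lambda>n. \<Sum>i<n. smulH (ipH x (e i)) (e i)) \<longlonglongrightarrow> x" by (simp add: sums_def)
  then show "x \<in> closure (range A)"
    unfolding closure_sequential
    by (intro exI[of _ "\<lambda>n. \<Sum>i<n. smulH (ipH x (e i)) (e i)"] conjI allI sum_e_in_range)
qed

text \<open>The ellipsoid contains the ball of radius \<open>a n\<close> in the span of
  \<open>e 0\<close> to \<open>e n\<close>: dividing the \<open>j\<close>-th coordinate by
  \<open>a j \<ge> a n\<close> costs at most a factor \<open>1 / a n\<close>.\<close>

lemma preimage_of_finite_sum:
  fixes c :: "nat \<Rightarrow> 'k" and n :: nat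
  defines "z \<equiv> \<Sum>j\<le>n. smulH (c j) (e j)"
  shows "\<exists>x. A x = z \<and> norm x \<le> norm z / a n"
proof (intro exI conjI)
  define d where "d j = c j * of_real (1 / a j)" for j
  show "A (\<Sum>j\<le>n. smulG (d j) (g j)) = z"
    unfolding A_sum_g z_def
  proof (intro sum.cong refl)
    fix j
    have "a j *\<^sub>R e j = smulH (of_real (a j)) (e j)" by (rule H.smul_of_real[symmetric])
    then have "smulH (d j) (a j *\<^sub>R e j) = smulH (c j * (of_real (1 / a j) * of_real (a j))) (e j)"
      by (simp add: d_def mult.assoc)
    then show "smulH (d j) (a j *\<^sub>R e j) = smulH (c j) (e j)"
      using a_pos[of j] by (simp flip: of_real_mult)
  qed
  show "norm (\<Sum>j\<le>n. smulG (d j) (g j)) \<le> norm z / a n"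
  proof (rule power2_le_imp_le)
    have "(norm (\<Sum>j\<le>n. smulG (d j) (g j)))\<^sup>2 = (\<Sum>j\<le>n. (norm (c j))\<^sup>2 / (a j)\<^sup>2)"
      using a_pos by (simp add: G.norm_orthonormal_sum[OF orthonormal_g] d_def norm_mult
        norm_divide power_divide abs_of_pos)
    also have "\<dots> \<le> (\<Sum>j\<le>n. (norm (c j))\<^sup>2 / (a n)\<^sup>2)"
      using a_pos decseqD[OF a_decseq]
      by (intro sum_mono divide_left_mono power_mono)
        (auto intro: less_imp_le mult_pos_pos zero_less_power)
    also have "\<dots> = (norm z / a n)\<^sup>2"
      by (simp add: z_def H.norm_orthonormal_sum[OF orthonormal_e] power_divide sum_divide_distrib)
    finally show "(norm (\<Sum>j\<le>n. smulG (d j) (g j)))\<^sup>2 \<le> (norm z / a n)\<^sup>2" .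
  qed (use a_pos[of n] in simp)
qed

text \<open>Lower bound: the \<open>n + 1\<close> vectors \<open>e 0\<close> to \<open>e n\<close>
  span a nonzero vector orthogonal to any \<open>n\<close>-dimensional \<open>X\<close>, and the
  ellipsoid reaches to norm \<open>a n\<close> in that direction. Upper bound: the span of the first
  \<open>n\<close> vectors \<open>e k\<close> is optimal, since the remainder of the expansion has
  norm at most \<open>a n\<close>.\<close>

theorem kolmogorov_width_ellipsoid: "kolmogorov_width smulH n (A ` cball 0 1) = a n"
proof -
  define K where "K = A ` cball 0 1"
  define D where "D X x = (INF z\<in>X. norm (x - z))" for X and x :: 'h
  define W where "W X = (SUP x\<in>K. D X x)" for X
  have K: "K \<noteq> {}" by (auto simp: K_def)
  have bddD: "bdd_below ((\<lambda>z. norm (x - z)) ` X)" for x X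
    by (rule bdd_belowI[of _ 0]) auto
  have lower: "a n \<le> W X" if "subspace_of_dim smulH n X" for X
  proof -
    from that obtain B where B: "finite B" "card B = n" "X = H.span B"
      by (auto simp: subspace_of_dim_def)
    have X0: "0 \<in> X" by (simp add: B H.span_zero)
    \<comment> \<open>A real supremum bounds its members only for a set that is bounded above;
      comparing with \<open>0 \<in> X\<close> supplies this bound.\<close>
    have "D X x \<le> a 0" if "x \<in> K" for x
    proof -
      have "D X x \<le> norm (x - 0)" unfolding D_def using X0 by (intro cINF_lower bddD)
      also from that obtain y where y: "x = A y" "norm y \<le> 1" by (auto simp: K_def)
      then have "norm (x - 0) \<le> a 0 * norm y" using norm_A_le[of 0 y] by simp
      also have "\<dots> \<le> a 0" using y(2) a_pos[of 0] by (intro mult_left_le) auto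
      finally show ?thesis .
    qed
    then have bdd: "bdd_above (D X ` K)" by (intro bdd_aboveI[of _ "a 0"]) auto
    have "card B < card {..n}" using B by simp
    from homogeneous_system_nontrivial_solution[OF B(1) finite_atMost this, of "\<lambda>b j. ipH (e j) b"]
    obtain c where c: "\<exists>j\<in>{..n}. c j \<noteq> 0" "\<forall>b\<in>B. (\<Sum>j\<le>n. c j * ipH (e j) b) = 0" by blast
    define w where "w = (\<Sum>j\<le>n. smulH (c j) (e j))"
    have wB: "ipH w b = 0" if "b \<in> B" for b
      using c(2) that by (simp add: w_def H.ip_sum_left H.ip_smul_left)
    from c(1) have "(norm w)\<^sup>2 \<noteq> 0"
      by (simp add: w_def H.norm_orthonormal_sum[OF orthonormal_e] sum_nonneg_eq_0_iff)
    then have w: "norm w > 0" by simp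
    from preimage_of_finite_sum[of c n] obtain q where q: "A q = w" "norm q \<le> norm w / a n"
      by (auto simp: w_def)
    \<comment> \<open>The vector \<open>w\<close> rescaled to norm \<open>a n\<close>, the largest
      size for which the preimage bound keeps it in the ellipsoid.\<close>
    define v where "v = (a n / norm w) *\<^sub>R w"
    have "v = A ((a n / norm w) *\<^sub>R q)" by (simp add: v_def A.scaleR q)
    moreover have "norm ((a n / norm w) *\<^sub>R q) \<le> 1" using q(2) w a_pos[of n] by (simp add: field_simps)
    ultimately have vK: "v \<in> K" by (auto simp: K_def)
    have nv: "norm v = a n" using w a_pos[of n] by (simp add: v_def)
    have "a n \<le> norm (v - z)" if "z \<in> X" for z
    proof -
      have "ipH v (- z) = 0"
        using H.ip_span_eq_0[of z B v] wB that
        by (simp add: B v_def H.ip_scaleR_left H.ip_minus_right)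
      from H.pythagoras[OF this] have "(norm v)\<^sup>2 \<le> (norm (v - z))\<^sup>2" by simp
      then show ?thesis using nv power2_le_imp_le norm_ge_zero by metis
    qed
    then have "a n \<le> D X v" unfolding D_def using X0 by (intro cINF_greatest) auto
    also have "\<dots> \<le> W X" unfolding W_def by (rule cSUP_upper[OF vK bdd])
    finally show ?thesis .
  qed
  define E where "E = H.span (e ` {..<n})"
  have E: "subspace_of_dim smulH n E"
    unfolding E_def by (rule H.orthonormal_subspace_of_dim[OF orthonormal_e])
  have "W E \<le> a n"
    unfolding W_def
  proof (rule cSUP_least[OF K])
    fix x assume "x \<in> K"
    then obtain y where y: "x = A y" "norm y \<le> 1" by (auto simp: K_def)
    define s where "s = (\<Sum>k<n. smulG (ipG y (g k)) (g k))"
    have "smulH c (a k *\<^sub>R e k) \<in> E" if "k < n" for c k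
    proof -
      have "smulH c (a k *\<^sub>R e k) = smulH c (smulH (of_real (a k)) (e k))" by (simp add: H.smul_of_real)
      then show ?thesis unfolding E_def using that by (simp add: H.span_scale H.span_base)
    qed
    then have As: "A s \<in> E" unfolding s_def A_sum_g by (auto simp: E_def intro!: H.span_sum)
    have "D E x \<le> norm (x - A s)" unfolding D_def by (rule cINF_lower[OF bddD As])
    also have "\<dots> = norm (A (y - s))" by (simp add: y A.diff)
    also have "\<dots> \<le> a n * norm (y - s)"
      by (intro norm_A_le) (simp add: s_def G.ip_diff_left G.ip_orthonormal_sum[OF orthonormal_g])
    also have "norm (y - s) \<le> 1"
      unfolding s_def by (rule order_trans[OF G.norm_orthonormal_residual_le[OF orthonormal_g] y(2)]) simp
    finally show "D E x \<le> a n" using a_pos[of n] by simp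
  qed
  then have "(INF X\<in>{X. subspace_of_dim smulH n X}. W X) = a n"
    using E lower by (intro antisym cINF_greatest order_trans[OF cINF_lower])
      (auto intro: bdd_belowI[of _ "a n"])
  then show ?thesis by (simp add: kolmogorov_width_def W_def D_def K_def)
qed

text \<open>A positive lower limit bounds all but finitely many ratios from below. The finitely many
  others are positive, so a minimum gives one bound valid for every \<open>n\<close>.\<close>

lemma lacunary_widths_iff:
  "lacunary (\<lambda>n. kolmogorov_width smulH n (A ` cball 0 1)) \<longleftrightarrow> \<not> (\<exists>d>0. \<forall>n. d * a n \<le> a (Suc n))"
proof -
  have "lacunary a \<longleftrightarrow> liminf (\<lambda>n. ereal (a (Suc n) / a n)) = 0"
    using a_pos a_decseq a_lim by (simp add: lacunary_def)
  also have "\<dots> \<longleftrightarrow> \<not> (\<exists>d>0. \<forall>n. d * a n \<le> a (Suc n))"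
  proof
    assume 0: "liminf (\<lambda>n. ereal (a (Suc n) / a n)) = 0"
    show "\<not> (\<exists>d>0. \<forall>n. d * a n \<le> a (Suc n))"
    proof
      assume "\<exists>d>0. \<forall>n. d * a n \<le> a (Suc n)"
      then obtain d where d: "d > 0" "\<And>n. d * a n \<le> a (Suc n)" by blast
      have "ereal d \<le> liminf (\<lambda>n. ereal (a (Suc n) / a n))"
        using d(2) a_pos by (intro Liminf_bounded always_eventually) (simp add: field_simps)
      with 0 d(1) show False by simp
    qed
  next
    assume neg: "\<not> (\<exists>d>0. \<forall>n. d * a n \<le> a (Suc n))"
    show "liminf (\<lambda>n. ereal (a (Suc n) / a n)) = 0"
    proof (rule ccontr)
      assume "liminf (\<lambda>n. ereal (a (Suc n) / a n)) \<noteq> 0"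
      moreover have "0 \<le> liminf (\<lambda>n. ereal (a (Suc n) / a n))"
        using a_pos by (intro Liminf_bounded always_eventually) (simp add: less_imp_le)
      ultimately have "0 < liminf (\<lambda>n. ereal (a (Suc n) / a n))" by simp
      then obtain d where d: "0 < ereal d" "ereal d < liminf (\<lambda>n. ereal (a (Suc n) / a n))"
        using ereal_dense2 by blast
      from less_LiminfD[OF d(2)] obtain N where N: "\<And>n. n \<ge> N \<Longrightarrow> d < a (Suc n) / a n"
        by (auto simp: eventually_sequentially)
      define m where "m = Min (insert d ((\<lambda>n. a (Suc n) / a n) ` {..N}))"
      have "m > 0" using d(1) a_pos by (auto simp: m_def)
      moreover have "m * a n \<le> a (Suc n)" for n
      proof -
        have "m \<le> a (Suc n) / a n"
        proof (cases "n \<le> N")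
          case True
          then show ?thesis unfolding m_def by (intro Min_le) auto
        next
          case False
          have "m \<le> d" unfolding m_def by (intro Min_le) auto
          with N[of n] False show ?thesis by simp
        qed
        then show ?thesis using a_pos[of n] by (simp add: field_simps)
      qed
      ultimately show False using neg by blast
    qed
  qed
  finally show ?thesis by (simp add: kolmogorov_width_ellipsoid)
qed

text \<open>The closed graph theorem in coordinates.\<close>

lemma bounded_lift:
  assumes T: "bounded_linear T" and inv: "T ` range A \<subseteq> range A"
  obtains C where "C > 0" "\<And>x. \<exists>x'. A x' = T (A x) \<and> norm x' \<le> C * norm x"
proof -
  \<comment> \<open>If \<open>T (A x) = A y\<close>, then \<open>q N x\<close> is the sum of the
    first \<open>N\<close> squared coordinates of \<open>y\<close> with respect to \<open>g\<close>.
    Written through \<open>T (A x)\<close>, it is visibly continuous in \<open>x\<close>.\<close>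
  define q where "q N x = (\<Sum>k<N. (norm (ipH (T (A x)) (e k)) / a k)\<^sup>2)" for N x
  define F where "F n = {x. \<forall>N. q N x \<le> (real n)\<^sup>2}" for n
  have bl: "bounded_linear (\<lambda>x. ipH (T (A x)) (e k))" for k
    by (intro bounded_linear_compose[OF H.bounded_linear_ip_left]
        bounded_linear_compose[OF T bounded_linear_A])
  have q_eq: "q N x = (\<Sum>k<N. (norm (ipG y (g k)))\<^sup>2)" if "T (A x) = A y" for N x y
    using a_pos by (simp add: q_def that ip_A_e norm_mult abs_of_pos less_imp_neq[symmetric])
  have "closed (F n)" for n
    unfolding F_def q_def
    by (intro closed_Collect_all closed_Collect_le continuous_intros
        bounded_linear.continuous_on[OF bl]) (use a_pos in \<open>auto simp: less_imp_neq[symmetric]\<close>)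
  moreover have "(\<Union>n. F n) = UNIV"
  proof (intro set_eqI iffI UNIV_I)
    fix x
    obtain y where y: "T (A x) = A y" using inv by blast
    obtain n :: nat where n: "norm y \<le> n" using real_arch_simple by blast
    have "q N x \<le> (real n)\<^sup>2" for N
      unfolding q_eq[OF y]
      by (rule order_trans[OF G.bessel_finite[OF orthonormal_g]]) (use n in \<open>auto intro: power_mono\<close>)
    then show "x \<in> (\<Union>n. F n)" by (auto simp: F_def)
  qed
  \<comment> \<open>The closed sets \<open>F n\<close> cover the space, so by Baire one of them
    contains a ball. Subtracting its centre and rescaling turns this into a bound on the whole
    space.\<close>
  moreover have "euclidean interior_of (\<Union>(range F)) = {}" if "\<And>n. closed (F n)" "\<And>n. interior (F n) = {}"
    by (rule Baire_category_alt) (use that completely_metrizable_space_euclidean in auto)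
  ultimately obtain n where "interior (F n) \<noteq> {}" by auto
  then obtain x0 r where r: "r > 0" "ball x0 r \<subseteq> F n" by (meson equals0I mem_interior)
  have q_diff: "q N (x - y) \<le> 2 * q N x + 2 * q N y" for N x y
  proof -
    have "(norm (u - v) / d)\<^sup>2 \<le> 2 * (norm u / d)\<^sup>2 + 2 * (norm v / d)\<^sup>2" for u v :: 'k and d :: real
    proof -
      have "(norm (u - v))\<^sup>2 \<le> (norm u + norm v)\<^sup>2"
        by (intro power_mono norm_triangle_ineq4) auto
      also have "\<dots> \<le> 2 * (norm u)\<^sup>2 + 2 * (norm v)\<^sup>2"
        using zero_le_power2[of "norm u - norm v"] by (simp add: power2_eq_square algebra_simps)
      finally have "(norm (u - v))\<^sup>2 / d\<^sup>2 \<le> (2 * (norm u)\<^sup>2 + 2 * (norm v)\<^sup>2) / d\<^sup>2"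
        by (intro divide_right_mono) auto
      then show ?thesis by (simp add: power_divide add_divide_distrib)
    qed
    then show ?thesis
      by (auto simp: q_def A.diff bounded_linear.linear[OF T, THEN linear_diff] H.ip_diff_left
        sum_distrib_left sum.distrib[symmetric] intro!: sum_mono)
  qed
  have q_scale: "q N (c *\<^sub>R x) = c\<^sup>2 * q N x" for N c x
    by (simp add: q_def A.scaleR bounded_linear.linear[OF T, THEN linear_scale] H.ip_scaleR_left
      sum_distrib_left power_divide power_mult_distrib)
  \<comment> \<open>With \<open>c = r / (2 * norm x)\<close> this gives
    \<open>c * (C * norm x) = 2 * (real n + 1)\<close>. Using \<open>n + 1\<close> in place of
    \<open>n\<close> keeps \<open>C\<close> positive even for \<open>n = 0\<close>.\<close>
  define C where "C = 4 * (real n + 1) / r"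
  have C: "C > 0" using r by (simp add: C_def)
  have bound: "q N x \<le> (C * norm x)\<^sup>2" for N x
  proof (cases "x = 0")
    case True
    have "q N (0 *\<^sub>R x) = 0" unfolding q_scale by simp
    with True show ?thesis by simp
  next
    case False
    define c where "c = r / (2 * norm x)"
    have c: "c > 0" using False r by (simp add: c_def)
    have "x0 + c *\<^sub>R x \<in> ball x0 r" "x0 \<in> ball x0 r" using False r by (auto simp: dist_norm c_def)
    then have "x0 + c *\<^sub>R x \<in> F n" "x0 \<in> F n" using r(2) by blast+
    then have "q N (x0 + c *\<^sub>R x) \<le> (real n)\<^sup>2" "q N x0 \<le> (real n)\<^sup>2" by (auto simp: F_def)
    with q_diff[of N "x0 + c *\<^sub>R x" x0] have "c\<^sup>2 * q N x \<le> (2 * real n)\<^sup>2"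
      by (simp add: q_scale power_mult_distrib)
    also have "\<dots> \<le> (2 * (real n + 1))\<^sup>2" by (intro power_mono) auto
    also have "2 * (real n + 1) = c * (C * norm x)" using False r by (simp add: c_def C_def field_simps)
    finally have "c\<^sup>2 * q N x \<le> c\<^sup>2 * (C * norm x)\<^sup>2" by (simp only: power_mult_distrib)
    then show ?thesis using c by simp
  qed
  have "\<exists>x'. A x' = T (A x) \<and> norm x' \<le> C * norm x" for x
  proof -
    obtain y where y: "T (A x) = A y" using inv by blast
    \<comment> \<open>Projecting \<open>y\<close> onto the closed span of \<open>g\<close> leaves
      its image unchanged and makes the squared norm equal to the sum of the squared coordinates,
      which \<open>q\<close> controls.\<close>
    define x' where "x' = G.transport g g y"
    have "A x' = T (A x)" unfolding y x'_def
      by (intro A_eqI G.ip_transport orthonormal_g)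
    moreover have "norm x' \<le> C * norm x"
    proof (rule power2_le_imp_le)
      have "(norm x')\<^sup>2 = (\<Sum>k. (norm (ipG y (g k)))\<^sup>2)"
        unfolding x'_def G.transport_def
        by (rule G.riesz_fischer(2)[OF orthonormal_g G.bessel_summable(1)[OF orthonormal_g]])
      also have "\<dots> \<le> (C * norm x)\<^sup>2"
        by (rule suminf_le_const[OF G.bessel_summable(1)[OF orthonormal_g]])
          (simp add: bound flip: q_eq[OF y])
      finally show "(norm x')\<^sup>2 \<le> (C * norm x)\<^sup>2" .
    qed (use C in simp)
    ultimately show ?thesis by blast
  qed
  with C that show ?thesis by blast
qed

end

section \<open>Weak operator closures\<close>

context hilbert_space
begin

lemma topspace_weak_operator_topology:
  "topspace (weak_operator_topology smul ip) = bounded_ops smul smul"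
proof -
  have "bounded_ops smul smul \<in> {{T \<in> bounded_ops smul smul. ip (T x) y \<in> U} |x y U. open U}"
    by (intro CollectI exI[of _ undefined] exI[of _ UNIV]) auto
  then show ?thesis unfolding weak_operator_topology_def topology_generated_by_topspace by blast
qed

text \<open>Strong convergence suffices. Lying in an open set eventually along \<open>F\<close>
  holds for the generating sets and survives finite intersections and unions, so induction over the
  generated topology applies.\<close>

lemma weak_operator_closureI:
  assumes F: "\<And>n. F n \<in> \<A>" and sub: "\<A> \<subseteq> bounded_ops smul smul" and S: "S \<in> bounded_ops smul smul"
    and lim: "\<And>x. (\<lambda>n. F n x) \<longlonglongrightarrow> S x"
  shows "S \<in> weak_operator_topology smul ip closure_of \<A>"
proof -
  let ?B = "{{T \<in> bounded_ops smul smul. ip (T x) y \<in> U} |x y U. open U}"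
  have ev: "\<forall>\<^sub>F n in sequentially. F n \<in> W" if "generate_topology_on ?B W" "S \<in> W" for W
    using that
  proof (induction rule: generate_topology_on.induct)
    case (Int V W)
    then show ?case by (auto intro: eventually_conj)
  next
    case (UN K)
    then obtain V where "V \<in> K" "\<forall>\<^sub>F n in sequentially. F n \<in> V" by blast
    then show ?case by (auto elim: eventually_mono)
  next
    case (Basis V)
    then obtain x y U where V: "V = {T \<in> bounded_ops smul smul. ip (T x) y \<in> U}" "open U"
      "ip (S x) y \<in> U" by auto
    have "(\<lambda>n. ip (F n x) y) \<longlonglongrightarrow> ip (S x) y"
      by (rule bounded_linear.tendsto[OF bounded_linear_ip_left lim])
    from topological_tendstoD[OF this V(2,3)] show ?case
      using F sub by (auto simp: V(1) elim!: eventually_mono)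
  qed simp
  have "\<exists>T. T \<in> \<A> \<and> T \<in> W" if "S \<in> W" "openin (weak_operator_topology smul ip) W" for W
  proof -
    from that have "generate_topology_on ?B W"
      by (simp add: weak_operator_topology_def openin_topology_generated_by_iff)
    from eventually_happens'[OF sequentially_bot ev[OF this that(1)]] F show ?thesis by blast
  qed
  then show ?thesis using S by (auto simp: in_closure_of topspace_weak_operator_topology)
qed

text \<open>One generating neighbourhood: an operator is excluded from the closure by exhibiting a
  single matrix coefficient.\<close>

lemma weak_operator_closureD:
  assumes S: "S \<in> weak_operator_topology smul ip closure_of \<A>" and U: "open U" "ip (S x) y \<in> U"
  shows "\<exists>T\<in>\<A>. ip (T x) y \<in> U"
proof -
  let ?W = "{T \<in> bounded_ops smul smul. ip (T x) y \<in> U}"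
  have W: "openin (weak_operator_topology smul ip) ?W"
    unfolding weak_operator_topology_def by (rule topology_generated_by_Basis) (use U in blast)
  have SW: "S \<in> ?W"
    using S U by (auto simp: in_closure_of topspace_weak_operator_topology)
  have meets: "\<exists>T. T \<in> \<A> \<and> T \<in> W"
    if "S \<in> W" "openin (weak_operator_topology smul ip) W" for W
    using S that by (simp add: in_closure_of)
  from meets[OF SW W] show ?thesis by blast
qed

lemma bounded_ops_rank_one: "(\<lambda>x. smul (ip x u) v) \<in> bounded_ops smul smul"
  unfolding bounded_ops_def
  by (auto intro!: bounded_linear_compose[OF bounded_linear_smul_left bounded_linear_ip_left]
    simp: ip_smul_left)

lemma bounded_ops_add:
  "S \<in> bounded_ops smul smul \<Longrightarrow> T \<in> bounded_ops smul smul \<Longrightarrow> (\<lambda>x. S x + T x) \<in> bounded_ops smul smul"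
  by (simp add: bounded_ops_def bounded_linear_add scale_right_distrib)

lemma bounded_ops_diff:
  "S \<in> bounded_ops smul smul \<Longrightarrow> T \<in> bounded_ops smul smul \<Longrightarrow> (\<lambda>x. S x - T x) \<in> bounded_ops smul smul"
  by (simp add: bounded_ops_def bounded_linear_sub scale_right_diff_distrib)

lemma bounded_ops_id: "(\<lambda>x. x) \<in> bounded_ops smul smul"
  by (simp add: bounded_ops_def bounded_linear_ident)

lemma bounded_ops_compose:
  "S \<in> bounded_ops smul smul \<Longrightarrow> T \<in> bounded_ops smul smul \<Longrightarrow> (\<lambda>x. S (T x)) \<in> bounded_ops smul smul"
  by (simp add: bounded_ops_def bounded_linear_compose)

lemma bounded_ops_sum:
  "(\<And>i. i \<in> I \<Longrightarrow> S i \<in> bounded_ops smul smul) \<Longrightarrow> (\<lambda>x. \<Sum>i\<in>I. S i x) \<in> bounded_ops smul smul"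
  by (simp add: bounded_ops_def bounded_linear_sum scale_sum_right)

text \<open>The invertible operator induces a surjection of a finite-dimensional quotient, which is therefore injective.\<close>

lemma finite_codim_inverse_invariant:
  assumes fc: "finite_codim smul M" and M: "subspace M"
    and T: "T \<in> bounded_ops smul smul" and S: "S \<in> bounded_ops smul smul"
    and TS: "\<And>x. T (S x) = x" and inv: "T ` M \<subseteq> M"
  shows "S ` M \<subseteq> M"
proof
  fix x assume "x \<in> S ` M"
  then obtain m where m: "m \<in> M" "x = S m" by blast
  interpret T: bounded_linear T using T by (simp add: bounded_ops_def)
  have T_smul: "T (smul c x) = smul c (T x)" for c x using T by (simp add: bounded_ops_def)
  from fc obtain B0 where B0: "finite B0" "M \<inter> span B0 = {0}"
    and dec: "\<And>x. \<exists>m\<in>M. \<exists>f\<in>span B0. x = m + f"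
    unfolding finite_codim_def finite_dim_def by metis
  \<comment> \<open>A basis of the complement, so that the elements can be counted.\<close>
  obtain B where B: "B \<subseteq> B0" "independent B" "B0 \<subseteq> span B"
    using maximal_independent_subset[of B0] by blast
  have span_B: "span B = span B0"
    using B span_mono[OF B(1)] span_minimal[OF B(3) subspace_span] by auto
  have finB: "finite B" using B(1) B0(1) by (rule finite_subset)
  have MB: "v = 0" if "v \<in> M" "v \<in> span B" for v using that B0(2) span_B by auto
  \<comment> \<open>Here \<open>\<phi> b\<close> is the component of \<open>T b\<close> in the
    complement of \<open>M\<close>; it represents the map induced by \<open>T\<close> on the
    quotient by \<open>M\<close>.\<close>
  from dec span_B have "\<forall>b. \<exists>m f. m \<in> M \<and> f \<in> span B \<and> T b = m + f" by metis
  then obtain \<mu> \<phi> where \<phi>: "\<And>b. \<mu> b \<in> M" "\<And>b. \<phi> b \<in> span B" "\<And>b. T b = \<mu> b + \<phi> b" by metis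
  have T_sum: "T (\<Sum>b\<in>B. smul (d b) b) = (\<Sum>b\<in>B. smul (d b) (\<mu> b)) + (\<Sum>b\<in>B. smul (d b) (\<phi> b))" for d
  proof -
    have "T (\<Sum>b\<in>B. smul (d b) b) = (\<Sum>b\<in>B. smul (d b) (T b))" by (simp add: T.sum T_smul)
    then show ?thesis by (simp add: \<phi>(3) scale_right_distrib sum.distrib)
  qed
  have \<mu>_sum: "(\<Sum>b\<in>B. smul (d b) (\<mu> b)) \<in> M" for d
    using \<phi>(1) M by (intro subspace_sum subspace_scale) auto
  have \<phi>_sum: "(\<Sum>b\<in>B. smul (d b) (\<phi> b)) \<in> span B" for d
    using \<phi>(2) by (intro span_sum span_scale) auto
  have surj: "span B \<subseteq> span (\<phi> ` B)"
  proof
    fix f assume f: "f \<in> span B"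
    from dec[of "S f"] span_B obtain m1 h where mh: "m1 \<in> M" "h \<in> span B" "S f = m1 + h" by metis
    from mh(2) obtain d where d: "h = (\<Sum>b\<in>B. smul (d b) b)" using span_finite[OF finB] by auto
    have "f = T m1 + T h" by (metis TS mh(3) T.add)
    then have "f - (\<Sum>b\<in>B. smul (d b) (\<phi> b)) = T m1 + (\<Sum>b\<in>B. smul (d b) (\<mu> b))"
      by (simp add: d T_sum)
    moreover have "T m1 + (\<Sum>b\<in>B. smul (d b) (\<mu> b)) \<in> M"
      using inv mh(1) \<mu>_sum M by (intro subspace_add) auto
    moreover have "f - (\<Sum>b\<in>B. smul (d b) (\<phi> b)) \<in> span B" using f \<phi>_sum by (rule span_diff)
    ultimately have "f - (\<Sum>b\<in>B. smul (d b) (\<phi> b)) = 0" by (metis MB)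
    then have "f = (\<Sum>b\<in>B. smul (d b) (\<phi> b))" by simp
    also have "\<dots> \<in> span (\<phi> ` B)" by (intro span_sum span_scale span_base imageI)
    finally show "f \<in> span (\<phi> ` B)" .
  qed
  from dec[of x] span_B obtain m1 h where mh: "m1 \<in> M" "h \<in> span B" "x = m1 + h" by metis
  from mh(2) obtain d where d: "h = (\<Sum>b\<in>B. smul (d b) b)" using span_finite[OF finB] by auto
  have "T h = m - T m1" using TS[of m] by (simp add: m(2)[symmetric] mh(3) T.add algebra_simps)
  then have "(\<Sum>b\<in>B. smul (d b) (\<phi> b)) = m - T m1 - (\<Sum>b\<in>B. smul (d b) (\<mu> b))"
    by (simp add: d T_sum algebra_simps)
  moreover have "m - T m1 - (\<Sum>b\<in>B. smul (d b) (\<mu> b)) \<in> M"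
    using m(1) inv mh(1) \<mu>_sum M by (intro subspace_diff) auto
  ultimately have sum0: "(\<Sum>b\<in>B. smul (d b) (\<phi> b)) = 0" using \<phi>_sum by (metis MB)
  \<comment> \<open>A nonzero coefficient would make \<open>\<phi> b\<close> redundant, and fewer
    than \<open>card B\<close> vectors would span a space containing the independent set
    \<open>B\<close>.\<close>
  have "d b = 0" if b: "b \<in> B" for b
  proof (rule ccontr)
    assume db: "d b \<noteq> 0"
    have "smul (d b) (\<phi> b) = - (\<Sum>b\<in>B - {b}. smul (d b) (\<phi> b))"
      using sum0 sum.remove[OF finB b, of "\<lambda>b. smul (d b) (\<phi> b)"] by (simp add: eq_neg_iff_add_eq_0)
    also have "\<dots> \<in> span (\<phi> ` (B - {b}))" by (intro span_neg span_sum span_scale span_base imageI)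
    finally have "smul (inverse (d b)) (smul (d b) (\<phi> b)) \<in> span (\<phi> ` (B - {b}))" by (rule span_scale)
    then have "\<phi> b \<in> span (\<phi> ` (B - {b}))" using db by simp
    then have "\<phi> ` B \<subseteq> span (\<phi> ` (B - {b}))" by (auto intro: span_base)
    then have "span (\<phi> ` B) \<subseteq> span (\<phi> ` (B - {b}))" by (intro span_minimal subspace_span)
    with surj have "B \<subseteq> span (\<phi> ` (B - {b}))" using span_superset[of B] by blast
    from independent_span_bound[OF _ B(2) this] finB have "card B \<le> card (\<phi> ` (B - {b}))" by auto
    also have "\<dots> \<le> card (B - {b})" using finB by (intro card_image_le) auto
    also have "\<dots> < card B" using finB b by (intro card_Diff1_less)
    finally show False by simp
  qed
  then show "x \<in> M" using mh(1,3) d by simp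
qed

text \<open>The operator sending \<open>u k\<close> to \<open>u (s k)\<close> and fixing the
  orthogonal complement of the sequence. Keeping that complement fixed gives an invertible operator
  on the whole space from a bijection \<open>s\<close> even if \<open>u\<close> is not
  complete.\<close>

definition permutation_op :: "(nat \<Rightarrow> 'h) \<Rightarrow> (nat \<Rightarrow> nat) \<Rightarrow> 'h \<Rightarrow> 'h" where
  "permutation_op u s x = x - transport u u x + transport u (u \<circ> s) x"

context
  fixes u assumes u: "orthonormal u"
begin

lemma permutation_op_bounded_ops: "inj s \<Longrightarrow> permutation_op u s \<in> bounded_ops smul smul"
  unfolding permutation_op_def[abs_def]
  by (intro bounded_ops_add bounded_ops_diff bounded_ops_id transport_bounded_ops u orthonormal_comp)

lemma permutation_op_basis: "inj s \<Longrightarrow> permutation_op u s (u k) = u (s k)"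
  using transport_basis[OF u u] transport_basis[OF u orthonormal_comp[OF u]]
  by (simp add: permutation_op_def)

lemma permutation_op_cancel:
  assumes s: "inj s" and t: "inj t" and st: "\<And>k. s (t k) = k"
  shows "permutation_op u s (permutation_op u t x) = x"
proof -
  \<comment> \<open>The part of \<open>x\<close> orthogonal to all \<open>u k\<close>, which both
    operators fix.\<close>
  define r where "r = x - transport u u x"
  have bl: "bounded_linear (permutation_op u s)"
    and hom: "\<And>c x. permutation_op u s (smul c x) = smul c (permutation_op u s x)"
    using permutation_op_bounded_ops[OF s] by (auto simp: bounded_ops_def)
  have "ip r (u k) = 0" for k by (simp add: r_def ip_diff_left ip_transport[OF u u])
  then have r: "permutation_op u s r = r"
    by (simp add: permutation_op_def transport_orthogonal)
  have "(\<lambda>k. permutation_op u s (smul (ip x (u k)) ((u \<circ> t) k))) sums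
      permutation_op u s (transport u (u \<circ> t) x)"
    by (rule bounded_linear.sums[OF bl transport_sums[OF u orthonormal_comp[OF u t]]])
  then have "(\<lambda>k. smul (ip x (u k)) (u k)) sums permutation_op u s (transport u (u \<circ> t) x)"
    by (simp add: hom permutation_op_basis[OF s] st)
  then have "permutation_op u s (transport u (u \<circ> t) x) = transport u u x"
    using transport_sums[OF u u] by (rule sums_unique2)
  then have "permutation_op u s (r + transport u (u \<circ> t) x) = r + transport u u x"
    using bl r by (simp add: linear_simps)
  then show ?thesis by (simp add: permutation_op_def[of u t] r_def)
qed

end

end

section \<open>Operators leaving an ellipsoid range invariant\<close>

context schmidt_expansion
begin

lemma closure_invariant:
  "bounded_linear T \<Longrightarrow> T ` range A \<subseteq> closure (range A) \<Longrightarrow> T ` closure (range A) \<subseteq> closure (range A)"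
  using closure_bounded_linear_image_subset[of T "range A"] closure_minimal[OF _ closed_closure]
  by blast

lemma projection_in_closure: "H.transport e e x \<in> closure (range A)"
  unfolding closure_range_iff H.transport_def[of e e "H.transport e e x"]
    H.ip_transport[OF orthonormal_e orthonormal_e] by (simp add: H.transport_def)

lemma ip_residual_e: "ipH (x - H.transport e e x) (e k) = 0"
  by (simp add: H.ip_diff_left H.ip_transport[OF orthonormal_e orthonormal_e])

lemma ip_closure_eq_0:
  assumes "\<And>k. ipH v (e k) = 0" and m: "m \<in> closure (range A)"
  shows "ipH m v = 0"
proof -
  have "ipH (e k) v = 0" for k using assms(1) H.ip_sconj_eq_0 by blast
  moreover have "(\<lambda>k. ipH (smulH (ipH m (e k)) (e k)) v) sums ipH (H.transport e e m) v"
    by (rule bounded_linear.sums[OF H.bounded_linear_ip_left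
          H.transport_sums[OF orthonormal_e orthonormal_e]])
  ultimately have "(\<lambda>k. 0) sums ipH (H.transport e e m) v" by (simp add: H.ip_smul_left)
  with m show ?thesis using sums_unique2[OF sums_zero] by (simp add: closure_range_iff)
qed

text \<open>Reduces weak fullness to a statement about the closed subspace alone. Operators of the
  algebra preserve the closure of the range, and this passes to weak limits because a violation
  shows up in one matrix coefficient.\<close>

lemma closure_invariant_ops_iff:
  assumes S: "S \<in> bounded_ops smulH smulH"
  shows "S \<in> weak_operator_topology smulH ipH closure_of invariant_ops smulH (range A) \<longleftrightarrow>
    S ` closure (range A) \<subseteq> closure (range A)"
proof
  assume cl: "S \<in> weak_operator_topology smulH ipH closure_of invariant_ops smulH (range A)"
  show "S ` closure (range A) \<subseteq> closure (range A)"
  proof (intro image_subsetI, rule ccontr)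
    fix x assume x: "x \<in> closure (range A)" and Sx: "S x \<notin> closure (range A)"
    \<comment> \<open>The component of \<open>S x\<close> orthogonal to the closure. Pairing with
      \<open>q\<close> kills \<open>T x\<close> for every \<open>T\<close> in the algebra but gives
      \<open>ipH q q \<noteq> 0\<close> at \<open>S x\<close>.\<close>
    define q where "q = S x - H.transport e e (S x)"
    have orth: "ipH m q = 0" if "m \<in> closure (range A)" for m
      by (rule ip_closure_eq_0[OF _ that]) (simp add: q_def ip_residual_e)
    have "q \<noteq> 0" using Sx by (auto simp: q_def closure_range_iff)
    moreover have "ipH (S x) q = ipH q q"
      using orth[OF projection_in_closure, of "S x"] by (simp add: q_def H.ip_diff_left)
    ultimately have "ipH (S x) q \<in> - {0}" by simp
    from H.weak_operator_closureD[OF cl _ this]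
    obtain T where T: "T \<in> invariant_ops smulH (range A)" "ipH (T x) q \<noteq> 0" by auto
    from T(1) have "T x \<in> closure (range A)"
      using closure_invariant[of T] closure_subset x by (fastforce simp: invariant_ops_def bounded_ops_def)
    with orth T(2) show False by blast
  qed
next
  assume inv: "S ` closure (range A) \<subseteq> closure (range A)"
  have bl: "bounded_linear S" using S by (simp add: bounded_ops_def)
  define P where "P = H.transport e e"
  \<comment> \<open>The approximants truncate only the part of \<open>S\<close> acting on the closure of the range, where the finite
    combinations of the \<open>e k\<close> already lie in the range itself.\<close>
  define F where "F n x = S (x - P x) + (\<Sum>k<n. smulH (ipH (S (P x)) (e k)) (e k))" for n x
  have P: "P \<in> bounded_ops smulH smulH"
    unfolding P_def by (rule H.transport_bounded_ops[OF orthonormal_e orthonormal_e])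
  show "S \<in> weak_operator_topology smulH ipH closure_of invariant_ops smulH (range A)"
  proof (rule H.weak_operator_closureI)
    show "F n \<in> invariant_ops smulH (range A)" for n
      unfolding invariant_ops_def
    proof (intro CollectI conjI image_subsetI)
      show "F n \<in> bounded_ops smulH smulH"
        unfolding F_def[abs_def]
        by (intro H.bounded_ops_add H.bounded_ops_sum H.bounded_ops_compose[OF S]
            H.bounded_ops_compose[OF H.bounded_ops_rank_one] H.bounded_ops_diff H.bounded_ops_id P)
      fix y assume "y \<in> range A"
      then have "y \<in> closure (range A)" by (rule subsetD[OF closure_subset])
      then have "P y = y" by (simp only: P_def closure_range_iff)
      then have "F n y = (\<Sum>k<n. smulH (ipH (S y) (e k)) (e k))"
        using bl by (simp add: F_def linear_simps)
      then show "F n y \<in> range A" using sum_e_in_range by metis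
    qed
    show "(\<lambda>n. F n x) \<longlonglongrightarrow> S x" for x
    proof -
      have "S (P x) \<in> closure (range A)" using inv projection_in_closure by (auto simp: P_def)
      then have "H.transport e e (S (P x)) = S (P x)" by (simp add: closure_range_iff)
      then have "(\<lambda>n. \<Sum>k<n. smulH (ipH (S (P x)) (e k)) (e k)) \<longlonglongrightarrow> S (P x)"
        using H.transport_sums[OF orthonormal_e orthonormal_e, of "S (P x)"] by (simp add: sums_def)
      then have "(\<lambda>n. F n x) \<longlonglongrightarrow> S (x - P x) + S (P x)"
        unfolding F_def by (intro tendsto_intros)
      then show ?thesis using bl by (simp add: linear_simps)
    qed
  qed (use S in \<open>auto simp: invariant_ops_def\<close>)
qed

lemma weakly_full_invariant_ops_iff:
  "weakly_full smulH ipH (invariant_ops smulH (range A)) \<longleftrightarrow>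
    (\<forall>T\<in>invariant_ops smulH (range A). \<forall>S\<in>bounded_ops smulH smulH.
      S \<circ> T = id \<and> T \<circ> S = id \<longrightarrow> S ` closure (range A) \<subseteq> closure (range A))"
  unfolding weakly_full_def by (simp add: closure_invariant_ops_iff cong: ball_cong)

lemma subspace_closure_range: "H.subspace (closure (range A))"
proof -
  have "bounded_linear (H.transport e e)"
    "\<And>c x. H.transport e e (smulH c x) = smulH c (H.transport e e x)"
    using H.transport_bounded_ops[OF orthonormal_e orthonormal_e] by (auto simp: bounded_ops_def)
  then show ?thesis
    unfolding H.subspace_def by (auto simp: closure_range_iff linear_simps)
qed

section \<open>The three cases: finite codimension, lacunary widths, non-lacunary widths\<close>

lemma weakly_full_if_finite_codim:
  assumes "finite_codim smulH (closure (range A))"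
  shows "weakly_full smulH ipH (invariant_ops smulH (range A))"
  unfolding weakly_full_invariant_ops_iff
proof (intro ballI impI)
  fix T S assume T: "T \<in> invariant_ops smulH (range A)" and S: "S \<in> bounded_ops smulH smulH"
    and ST: "S \<circ> T = id \<and> T \<circ> S = id"
  have inv: "T ` closure (range A) \<subseteq> closure (range A)"
    using T by (intro closure_invariant order_trans[OF _ closure_subset])
      (auto simp: invariant_ops_def bounded_ops_def)
  have TS: "T (S x) = x" for x using ST by (simp add: fun_eq_iff)
  have "T \<in> bounded_ops smulH smulH" using T by (simp add: invariant_ops_def)
  from H.finite_codim_inverse_invariant[OF assms subspace_closure_range this S TS inv]
  show "S ` closure (range A) \<subseteq> closure (range A)" .
qed

text \<open>Among combinations \<open>w = T z + s y\<close> with \<open>z\<close> in the span of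
  \<open>e 0\<close> to \<open>e n\<close>, some nonzero one has its first \<open>n + 1\<close>
  coordinates equal to 0. A preimage of \<open>w\<close> under \<open>A\<close> has norm at most
  \<open>D * norm w / a n\<close>, while the vanishing coordinates give
  \<open>norm w \<le> a (Suc n)\<close> times that norm. The bound on the preimage rests on
  \<open>S y\<close> leaving the closure: it lets \<open>S w\<close> control \<open>z\<close> and
  \<open>s\<close> separately.\<close>

lemma ratio_bound_if_not_invariant:
  assumes T: "T \<in> invariant_ops smulH (range A)" and S: "S \<in> bounded_ops smulH smulH"
    and ST: "\<And>x. S (T x) = x" and y: "y \<in> range A" and Sy: "S y \<notin> closure (range A)"
  shows "\<exists>d>0. \<forall>n. d * a n \<le> a (Suc n)"
proof -
  have T': "bounded_linear T" "T ` range A \<subseteq> range A" and T_smul: "\<And>c x. T (smulH c x) = smulH c (T x)"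
    using T by (auto simp: invariant_ops_def bounded_ops_def)
  interpret T: bounded_linear T by (rule T'(1))
  interpret S: bounded_linear S using S by (simp add: bounded_ops_def)
  have S_smul: "S (smulH c x) = smulH c (S x)" for c x using S by (simp add: bounded_ops_def)
  obtain C where C: "C > 0" "\<And>x. \<exists>x'. A x' = T (A x) \<and> norm x' \<le> C * norm x"
    using bounded_lift[OF T'] by blast
  obtain K where K: "K > 0" "\<And>x. norm (S x) \<le> norm x * K" using S.pos_bounded by blast
  obtain x0 where x0: "A x0 = y" using y by blast
  define q where "q = S y - H.transport e e (S y)"
  have q: "norm q > 0" using Sy by (auto simp: q_def closure_range_iff)
  have orth: "ipH m q = 0" if "m \<in> closure (range A)" for m
    by (rule ip_closure_eq_0[OF _ that]) (simp add: q_def ip_residual_e)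
  have "ipH (S y) q = ipH q q"
    using orth[OF projection_in_closure, of "S y"] by (simp add: q_def H.ip_diff_left)
  then have ip_q: "norm (ipH (S y) q) = norm q * norm q"
    by (simp add: H.ip_norm norm_mult power2_eq_square)
  \<comment> \<open>\<open>L\<close> will bound \<open>norm z\<close> by \<open>norm (S w)\<close>.
    In \<open>D\<close>, the factor \<open>K\<close> bounds \<open>S\<close>, the term
    \<open>C * L\<close> accounts for the preimage of \<open>T z\<close>, and the last term for that
    of \<open>smulH s y\<close>.\<close>
  define L where "L = 1 + norm (S y) / norm q"
  define D where "D = K * (C * L + a 0 * (norm x0 / norm q))"
  have L: "L > 0" using q by (simp add: L_def add_pos_nonneg)
  have D: "D > 0" unfolding D_def using K C L q a_pos[of 0] by (intro mult_pos_pos add_pos_nonneg) auto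
  have "1 / D * a n \<le> a (Suc n)" for n
  proof -
    \<comment> \<open>Index \<open>Suc n\<close> stands for \<open>y\<close>, giving
      \<open>n + 2\<close> unknowns against the \<open>n + 1\<close> equations for the coordinates 0
      to \<open>n\<close>.\<close>
    define v where "v j = (if j \<le> n then T (e j) else y)" for j
    have "card {..n} < card {..Suc n}" by simp
    from homogeneous_system_nontrivial_solution[OF finite_atMost finite_atMost this, of "\<lambda>i j. ipH (v j) (e i)"]
    obtain c where c: "\<exists>j\<in>{..Suc n}. c j \<noteq> 0" "\<forall>i\<in>{..n}. (\<Sum>j\<le>Suc n. c j * ipH (v j) (e i)) = 0"
      by blast
    define z where "z = (\<Sum>j\<le>n. smulH (c j) (e j))"
    define s where "s = c (Suc n)"
    define w where "w = T z + smulH s y"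
    have "w = (\<Sum>j\<le>Suc n. smulH (c j) (v j))"
      by (simp add: w_def z_def s_def T.sum T_smul v_def)
    then have w_e: "ipH w (e i) = 0" if "i \<le> n" for i
      using c(2) that by (simp add: H.ip_add_left H.ip_sum_left H.ip_smul_left)
    have z: "z \<in> closure (range A)" using sum_e_in_range closure_subset unfolding z_def by blast
    have Sw: "S w = z + smulH s (S y)" by (simp add: w_def S.add S_smul ST)
    \<comment> \<open>Since \<open>z\<close> lies in the closure it is orthogonal to
      \<open>q\<close>, so pairing \<open>S w\<close> with \<open>q\<close> isolates the coefficient
      \<open>s\<close>.\<close>
    have "norm s * (norm q * norm q) = norm (ipH (S w) q)"
      by (simp add: Sw H.ip_add_left H.ip_smul_left orth[OF z] norm_mult ip_q)
    also have "\<dots> \<le> norm (S w) * norm q" by (rule H.cauchy_schwarz)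
    finally have s: "norm s \<le> norm (S w) / norm q" using q by (simp add: field_simps)
    have "norm z = norm (S w - smulH s (S y))" by (simp add: Sw)
    also have "\<dots> \<le> norm (S w) + norm s * norm (S y)"
      by (metis norm_triangle_ineq4 H.norm_smul)
    also have "\<dots> \<le> norm (S w) + norm (S w) / norm q * norm (S y)"
      using s by (intro add_left_mono mult_right_mono) auto
    also have "\<dots> = L * norm (S w)" by (simp add: L_def algebra_simps)
    finally have nz: "norm z \<le> L * norm (S w)" .
    have "w \<noteq> 0"
    proof
      assume "w = 0"
      then have "s = 0" "z = 0" using s nz by (simp_all add: S.zero)
      from this(2) have "(\<Sum>j\<le>n. (norm (c j))\<^sup>2) = 0"
        using H.norm_orthonormal_sum[OF orthonormal_e finite_atMost, of c n] by (simp add: z_def)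
      then have "\<forall>j\<le>n. c j = 0" by (simp add: sum_nonneg_eq_0_iff)
      with \<open>s = 0\<close> c(1) show False by (auto simp: s_def le_Suc_eq)
    qed
    obtain x1 where x1: "A x1 = z" "norm x1 \<le> norm z / a n"
      using preimage_of_finite_sum[of c n] by (auto simp: z_def)
    obtain x2 where x2: "A x2 = T z" "norm x2 \<le> C * norm x1" using C(2)[of x1] x1(1) by auto
    define x where "x = x2 + smulG s x0"
    have Ax: "A x = w" by (simp add: x_def w_def A.add A_smul x0 x2)
    have "ipG x (g k) = 0" if "k < Suc n" for k
      using w_e[of k] that ip_A_e[of x k] a_pos[of k] by (simp add: Ax)
    then have "norm w \<le> a (Suc n) * norm x" using norm_A_le[of "Suc n" x] by (simp add: Ax)
    also have "norm x \<le> norm (S w) * (C * L + a 0 * (norm x0 / norm q)) / a n"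
    proof -
      have "norm x \<le> norm x2 + norm s * norm x0"
        unfolding x_def by (metis norm_triangle_ineq G.norm_smul)
      also have "norm x2 \<le> C * (L * norm (S w) / a n)"
        using x2(2) x1(2) nz C(1) a_pos[of n]
        by (meson divide_right_mono less_imp_le mult_left_mono order_trans)
      \<comment> \<open>The factor \<open>a 0 / a n \<ge> 1\<close> only brings this term to the
        common denominator \<open>a n\<close>.\<close>
      also have "norm s * norm x0 \<le> (norm (S w) / norm q * norm x0) * (a 0 / a n)"
      proof -
        have "norm s * norm x0 \<le> norm (S w) / norm q * norm x0" using s by (rule mult_right_mono) simp
        moreover have "1 \<le> a 0 / a n" using decseqD[OF a_decseq, of 0 n] a_pos[of n] by simp
        moreover have "0 \<le> norm (S w) / norm q * norm x0" by simp
        ultimately have "norm s * norm x0 * 1 \<le> norm (S w) / norm q * norm x0 * (a 0 / a n)"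
          by (rule mult_mono) simp
        then show ?thesis by simp
      qed
      finally show ?thesis by (simp add: algebra_simps add_divide_distrib)
    qed
    also have "norm (S w) * (C * L + a 0 * (norm x0 / norm q)) / a n \<le> norm w * D / a n"
    proof -
      have "0 \<le> C * L + a 0 * (norm x0 / norm q)" using C L a_pos[of 0] by simp
      from mult_right_mono[OF K(2)[of w] this] show ?thesis
        using a_pos[of n] by (intro divide_right_mono) (simp_all add: D_def mult.assoc)
    qed
    finally have "norm w \<le> a (Suc n) * (norm w * D / a n)" using a_pos[of "Suc n"] by simp
    then have "norm w * 1 \<le> norm w * (a (Suc n) * (D / a n))" by (simp add: algebra_simps)
    moreover have "norm w > 0" using \<open>w \<noteq> 0\<close> by simp
    ultimately have "1 \<le> a (Suc n) * (D / a n)" by (simp only: mult_le_cancel_left_pos)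
    then show ?thesis using D a_pos[of n] by (simp add: field_simps)
  qed
  then show ?thesis using D by (intro exI[of _ "1 / D"]) auto
qed

lemma weakly_full_if_lacunary:
  assumes "lacunary (\<lambda>n. kolmogorov_width smulH n (A ` cball 0 1))"
  shows "weakly_full smulH ipH (invariant_ops smulH (range A))"
  unfolding weakly_full_invariant_ops_iff
proof (intro ballI impI)
  fix T S assume T: "T \<in> invariant_ops smulH (range A)" and S: "S \<in> bounded_ops smulH smulH"
    and ST: "S \<circ> T = id \<and> T \<circ> S = id"
  have "S (T x) = x" for x using ST by (simp add: fun_eq_iff)
  with assms T S have "S ` range A \<subseteq> closure (range A)"
    using ratio_bound_if_not_invariant[of T S] unfolding lacunary_widths_iff by blast
  then show "S ` closure (range A) \<subseteq> closure (range A)"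
    using S by (intro closure_invariant) (auto simp: bounded_ops_def)
qed

text \<open>If finitely many vectors \<open>X\<close> left no unit vector orthogonal to them and to
  all \<open>e k\<close>, the components of \<open>X\<close> orthogonal to the closure would span a
  finite-dimensional complement of it. Hence vectors can be chosen one at a time
  indefinitely.\<close>

lemma ex_orthonormal_complement:
  assumes "\<not> finite_codim smulH (closure (range A))"
  shows "\<exists>f. H.orthonormal f \<and> (\<forall>n k. ipH (f n) (e k) = 0)"
proof -
  define P where "P = H.transport e e"
  have PM: "P x \<in> closure (range A)" for x by (simp add: P_def projection_in_closure)
  have ex: "\<exists>v. norm v = 1 \<and> (\<forall>b\<in>X. ipH v b = 0) \<and> (\<forall>k. ipH v (e k) = 0)" if X: "finite X" for X
  proof (rule ccontr)
    assume no: "\<not> ?thesis"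
    define X' where "X' = (\<lambda>x. x - P x) ` X"
    have X': "finite X'" using X by (simp add: X'_def)
    have X'_e: "ipH (e k) y = 0" if "y \<in> H.span X'" for y k
      using that by (rule H.ip_span_eq_0)
        (auto simp: X'_def P_def ip_residual_e H.ip_sconj_eq_0[of "e k"])
    then have e_X': "ipH y (e k) = 0" if "y \<in> H.span X'" for y k
      using that H.ip_sconj_eq_0 by blast
    have "closure (range A) \<inter> H.span X' = {0}"
    proof (intro equalityI subsetI)
      fix y assume "y \<in> closure (range A) \<inter> H.span X'"
      then have y: "y \<in> closure (range A)" "y \<in> H.span X'" by blast+
      have "ipH y y = 0" by (rule ip_closure_eq_0[OF e_X'[OF y(2)] y(1)])
      then show "y \<in> {0}" by simp
    qed (simp add: H.span_zero H.subspace_0[OF subspace_closure_range])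
    moreover have "\<exists>m\<in>closure (range A). \<exists>f\<in>H.span X'. x = m + f" for x
    proof -
      obtain p where p: "p \<in> H.span X'" "\<forall>v\<in>X'. ipH (x - P x - p) v = 0"
        using H.finite_orthogonal_projection[OF X'] by blast
      \<comment> \<open>What remains of \<open>x\<close> after removing its components in the
        closure and in the span of \<open>X'\<close>. It is orthogonal to \<open>X\<close> and to
        all \<open>e k\<close>, so it must vanish.\<close>
      define v where "v = x - P x - p"
      have v_e: "ipH v (e k) = 0" for k
        unfolding v_def H.ip_diff_left[of "x - P x" p]
        using e_X'[OF p(1)] by (simp add: P_def ip_residual_e)
      have v_X: "ipH v b = 0" if "b \<in> X" for b
      proof -
        have "ipH v (b - P b) = 0" using p(2) that by (simp add: v_def X'_def)
        moreover have "ipH v (P b) = 0"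
          using ip_closure_eq_0[OF v_e PM] H.ip_sconj_eq_0 by blast
        ultimately show ?thesis by (simp add: H.ip_diff_right)
      qed
      have "v = 0"
      proof (rule ccontr)
        assume "v \<noteq> 0"
        then have "norm ((1 / norm v) *\<^sub>R v) = 1" by simp
        with no v_e v_X show False by (metis H.ip_scaleR_left scaleR_zero_right)
      qed
      then have "x = P x + p" by (simp add: v_def algebra_simps)
      with PM p(1) show ?thesis by blast
    qed
    ultimately have "finite_codim smulH (closure (range A))"
      using X' unfolding finite_codim_def finite_dim_def by blast
    with assms show False by simp
  qed
  define h where "h X = (SOME v. norm v = 1 \<and> (\<forall>b\<in>X. ipH v b = 0) \<and> (\<forall>k. ipH v (e k) = 0))" for X
  obtain f where "\<forall>n::nat. f n = h (f ` {..<n})"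
    by (rule exE[OF ex_seq_of_initial_image[of h]]) (rule that)
  then have fh: "f n = h (f ` {..<n})" for n by (rule spec)
  have f: "norm (f n) = 1 \<and> (\<forall>b\<in>f ` {..<n}. ipH (f n) b = 0) \<and> (\<forall>k. ipH (f n) (e k) = 0)" for n
    unfolding fh[of n] h_def by (rule someI_ex[OF ex]) simp
  have less: "ipH (f m) (f n) = 0" if "n < m" for m n using f[of m] that by auto
  have "ipH (f m) (f n) = 0" if "n \<noteq> m" for m n
    using that less H.ip_sconj_eq_0 by (metis nat_neq_iff)
  moreover have "ipH (f n) (f n) = 1" for n using f[of n] by (simp add: H.ip_norm)
  ultimately show ?thesis using f by (intro exI[of _ f]) (auto simp: H.orthonormal_def)
qed

text \<open>The shift asks for a preimage whose coordinate at \<open>g (Suc k)\<close> is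
  \<open>a k / a (Suc k)\<close> times the old one at \<open>g k\<close>. These factors are at most
  \<open>1 / d\<close>, so the new coordinates remain square summable.\<close>

lemma forward_shift_invariant:
  assumes T: "T \<in> bounded_ops smulH smulH" and Te: "\<And>k. T (e k) = e (Suc k)"
    and d: "d > 0" "\<And>n. d * a n \<le> a (Suc n)"
  shows "T ` range A \<subseteq> range A"
proof clarify
  fix x
  define r where "r k = a k / a (Suc k)" for k
  have r: "0 \<le> r k" "r k \<le> 1 / d" for k
    using d a_pos[of k] a_pos[of "Suc k"] d(2)[of k] by (auto simp: r_def field_simps)
  define c where "c k = of_real (r k) * ipG x (g k)" for k
  have "summable (\<lambda>k. (norm (c k))\<^sup>2)"
  proof (rule summable_comparison_test')
    show "summable (\<lambda>k. (1 / d)\<^sup>2 * (norm (ipG x (g k)))\<^sup>2)"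
      by (intro summable_mult G.bessel_summable orthonormal_g)
    show "norm ((norm (c k))\<^sup>2) \<le> (1 / d)\<^sup>2 * (norm (ipG x (g k)))\<^sup>2" for k
      using r[of k] by (auto simp: c_def norm_mult power_mult_distrib intro!: mult_right_mono power_mono)
  qed
  from G.riesz_fischer(1)[OF G.orthonormal_comp[OF orthonormal_g inj_Suc] this]
  obtain x' where "(\<lambda>k. smulG (c k) ((g \<circ> Suc) k)) sums x'" using summable_def by blast
  then have "(\<lambda>k. A (smulG (c k) ((g \<circ> Suc) k))) sums A x'" by (rule A.sums)
  moreover have "(\<lambda>k. T (smulH (ipG x (g k)) (a k *\<^sub>R e k))) sums T (A x)"
    using T by (intro bounded_linear.sums[OF _ A_sums]) (simp add: bounded_ops_def)
  moreover have "A (smulG (c k) ((g \<circ> Suc) k)) = T (smulH (ipG x (g k)) (a k *\<^sub>R e k))" for k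
  proof -
    have "A (smulG (c k) ((g \<circ> Suc) k)) = smulH (c k) (smulH (of_real (a (Suc k))) (e (Suc k)))"
      by (simp add: A_smul A_g H.smul_of_real)
    also have "\<dots> = smulH (of_real (r k * a (Suc k)) * ipG x (g k)) (e (Suc k))"
      by (simp add: c_def mult_ac)
    also have "r k * a (Suc k) = a k" using a_pos[of "Suc k"] by (simp add: r_def)
    also have "smulH (of_real (a k) * ipG x (g k)) (e (Suc k)) =
        T (smulH (ipG x (g k)) (smulH (of_real (a k)) (e k)))"
      using T by (simp add: bounded_ops_def Te mult.commute)
    finally show ?thesis by (simp add: H.smul_of_real)
  qed
  ultimately have "T (A x) = A x'" by (simp add: sums_unique2)
  then show "T (A x) \<in> range A" by simp
qed

lemma not_weakly_full_if_not_lacunary: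
  assumes "\<not> lacunary (\<lambda>n. kolmogorov_width smulH n (A ` cball 0 1))"
    and "\<not> finite_codim smulH (closure (range A))"
  shows "\<not> weakly_full smulH ipH (invariant_ops smulH (range A))"
proof -
  obtain d where d: "d > 0" "\<And>n. d * a n \<le> a (Suc n)" using assms(1) lacunary_widths_iff by blast
  obtain f where f: "H.orthonormal f" "\<And>n k. ipH (f n) (e k) = 0"
    using ex_orthonormal_complement[OF assms(2)] by blast
  \<comment> \<open>Interleaving \<open>e\<close> at even and \<open>f\<close> at odd positions lets
    a two-sided shift be written as a permutation of the natural numbers.\<close>
  define u where "u n = (if even n then e (n div 2) else f (n div 2))" for n
  have ef: "ipH (e k) (f n) = 0" for k n using f(2) H.ip_sconj_eq_0 by blast
  have idx: "i div 2 = j div 2 \<longleftrightarrow> i = j" if "even i \<longleftrightarrow> even j" for i j :: nat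
    using that by presburger
  have "ipH (u i) (u j) = (if i = j then 1 else 0)" for i j
    by (cases "even i"; cases "even j")
      (auto simp: u_def f(2) ef idx H.orthonormal_ip[OF orthonormal_e] H.orthonormal_ip[OF f(1)])
  then have u: "H.orthonormal u" by (simp add: H.orthonormal_def)
  \<comment> \<open>\<open>s\<close> moves \<open>u\<close> along \<open>\<dots> \<mapsto> f 1 \<mapsto> f 0 \<mapsto> e 0 \<mapsto> e 1 \<mapsto> \<dots>\<close>, and \<open>t\<close> is its inverse.\<close>
  define s :: "nat \<Rightarrow> nat" where "s n = (if even n then n + 2 else if n = 1 then 0 else n - 2)" for n
  define t :: "nat \<Rightarrow> nat" where "t n = (if odd n then n + 2 else if n = 0 then 1 else n - 2)" for n
  have st: "s (t n) = n" and ts: "t (s n) = n" for n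
    by (auto simp: s_def t_def) presburger+
  have s: "inj s" and t: "inj t" using st ts by (metis injI)+
  define T S where "T = H.permutation_op u s" and "S = H.permutation_op u t"
  have T: "T \<in> bounded_ops smulH smulH" and S: "S \<in> bounded_ops smulH smulH"
    unfolding T_def S_def by (intro H.permutation_op_bounded_ops u s t)+
  have "T (e k) = e (Suc k)" for k
    using H.permutation_op_basis[OF u s, of "2 * k"] by (simp add: T_def u_def s_def)
  then have "T \<in> invariant_ops smulH (range A)"
    using forward_shift_invariant[OF T _ d] T by (simp add: invariant_ops_def)
  moreover have "S \<circ> T = id \<and> T \<circ> S = id"
    by (auto simp: fun_eq_iff T_def S_def H.permutation_op_cancel[OF u] s t st ts)
  moreover have "\<not> S ` closure (range A) \<subseteq> closure (range A)"
  \<comment> \<open>The inverse shift takes \<open>e 0\<close> to \<open>f 0\<close>, which is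
    orthogonal to the closure.\<close>
  proof
    assume sub: "S ` closure (range A) \<subseteq> closure (range A)"
    have "S (e 0) = f 0"
      using H.permutation_op_basis[OF u t, of 0] by (simp add: S_def u_def t_def)
    moreover have "e 0 \<in> closure (range A)" using e_in_range closure_subset by blast
    ultimately have "f 0 \<in> closure (range A)" using sub by force
    from ip_closure_eq_0[OF f(2) this] have "ipH (f 0) (f 0) = 0" .
    then show False using H.orthonormal_ip[OF f(1), of 0 0] by simp
  qed
  ultimately show ?thesis using S unfolding weakly_full_invariant_ops_iff by blast
qed

end

theorem corollary7p2:
  fixes smulH :: "'k::hilbert_scalar \<Rightarrow> 'h::banach \<Rightarrow> 'h" and ipH :: "'h \<Rightarrow> 'h \<Rightarrow> 'k"
    and smulG :: "'k \<Rightarrow> 'g::banach \<Rightarrow> 'g" and ipG :: "'g \<Rightarrow> 'g \<Rightarrow> 'k"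
    and A :: "'g \<Rightarrow> 'h" and Y :: "'h set"
  assumes "hilbert_space smulH ipH"
    and "separable_space (euclidean :: 'h topology)"
    and "\<not> finite_dim smulH (UNIV :: 'h set)"
    and "hilbert_space smulG ipG"
    and "separable_space (euclidean :: 'g topology)"
    and "\<not> finite_dim smulG (UNIV :: 'g set)"
    and "compact_operator smulG smulH A"
    and "\<not> finite_dim smulH (range A)"
    and "Y = range A"
  shows "(finite_codim smulH (closure Y) \<longrightarrow>
           weakly_full smulH ipH (invariant_ops smulH Y)) \<and>
         (\<not> lacunary_range smulG smulH Y \<and> \<not> finite_codim smulH (closure Y) \<longrightarrow>
           \<not> weakly_full smulH ipH (invariant_ops smulH Y)) \<and>
         (lacunary_range smulG smulH Y \<longrightarrow>
           weakly_full smulH ipH (invariant_ops smulH Y))"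
proof -
  interpret hilbert_space_pair smulG ipG smulH ipH
    using assms(1,4) by (simp add: hilbert_space_pair_def)
  obtain a g e where "schmidt_expansion smulG ipG smulH ipH A a g e"
    using ex_schmidt_expansion[OF assms(7,8)] by blast
  then interpret schmidt_expansion smulG ipG smulH ipH A a g e .
  \<comment> \<open>The lacunary ellipsoid may come from another operator \<open>A'\<close> with
    range \<open>Y\<close>, so its own Schmidt expansion is used.\<close>
  have "weakly_full smulH ipH (invariant_ops smulH Y)" if "lacunary_range smulG smulH Y"
  proof -
    from that obtain A' where A': "compact_operator smulG smulH A'" "\<not> finite_dim smulH (range A')"
      "Y = range A'" and lac: "lacunary (\<lambda>n. kolmogorov_width smulH n (A' ` cball 0 1))"
      unfolding lacunary_range_def generating_ellipsoid_def by blast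
    obtain a' g' e' where "schmidt_expansion smulG ipG smulH ipH A' a' g' e'"
      using ex_schmidt_expansion[OF A'(1,2)] by blast
    from schmidt_expansion.weakly_full_if_lacunary[OF this lac] show ?thesis by (simp add: A'(3))
  qed
  \<comment> \<open>Read contrapositively: if \<open>Y\<close> is not lacunary, neither are the
    widths of the ellipsoid of \<open>A\<close>.\<close>
  moreover have "lacunary_range smulG smulH Y"
    if "lacunary (\<lambda>n. kolmogorov_width smulH n (A ` cball 0 1))"
    using that assms(7-9) unfolding lacunary_range_def generating_ellipsoid_def by blast
  ultimately show ?thesis
    using weakly_full_if_finite_codim not_weakly_full_if_not_lacunary by (auto simp: assms(9))
qed

end
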